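(* Let $X$ be a real random variable that is symmetric ($X$ and $-X$ have the same law) and has finite polynomial moments of every order. Let $\alpha\in(0,1)$, let $\phi_\alpha(x)=\mathrm{sign}(x)|x|^\alpha$, and let $\lambda_\alpha(\eta)=\log\mathbb{E}\left[e^{\eta\phi_\alpha(X)}\right]\in(-\infty,+\infty]$ for $\eta\in\mathbb{R}$. Assume that: (i) (non-trivial bounded domain) there is $\xi\in(0,+\infty)$ such that $\{\eta\in\mathbb{R}:\lambda_\alpha(\eta)<+\infty\}=(-\xi,\xi)$; (ii) (steepness) for every sequence $(\eta_n)_{n\in\mathbb{N}}$ in $(-\xi,\xi)$ converging to $\xi$ or to $-\xi$, one has $|\lambda_\alpha'(\eta_n)|\to+\infty$ as $n\to+\infty$; (iii) (bounded relative variance) setting $\mathcal{V}(\eta)=\dfrac{\lambda_\alpha''(\eta)}{\lambda_\alpha'(\eta)^2}$, there exist $\xi_0\in(0,\xi)$ and $\omega\in(0,+\infty)$ such that $\lambda_\alpha''$ is non-decreasing on $[\xi_0,\xi)$, $\mathcal{V}$ is non-increasing on $[\xi_0,\xi)$, and $\mathcal{V}(\eta)\leq\omega$ for all $\eta\in(\xi_0,\xi)$. Let $(X_i)_{i\geq 1}$ be i.i.d. copies of $X$ and $S_n=\frac1n\sum_{i=1}^n X_i$. Then $(S_n)_{n\geq1}$ satisfies a large deviations principle at speed $n^\alpha$ with rate function $I_\alpha$ given by $$\forall\,x\in\mathbb{R},\quad I_\alpha(x)=\xi|x|^\alpha.$$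
   Context: A sequence of random variables $(Z_n)_{n\geq1}$ with values in a topological space $\mathcal{Z}$ (with its Borel $\sigma$-field) satisfies a large deviations principle at speed $v_n$ with rate function $I:\mathcal{Z}\to[0,+\infty]$ if $I$ is lower semicontinuous and for every measurable set $B\subset\mathcal{Z}$, $$-\inf_{\mathring{B}} I\leq\liminf_{n\to+\infty}\frac{1}{v_n}\log\mathbb{P}(Z_n\in B)\leq\limsup_{n\to+\infty}\frac{1}{v_n}\log\mathbb{P}(Z_n\in B)\leq-\inf_{\overline{B}} I,$$ where $\mathring{B}$ and $\overline{B}$ are the interior and the closure of $B$. Here $\mathcal{Z}=\mathbb{R}$. The function $\lambda_\alpha$ is infinitely differentiable on the interior of its domain $\{\lambda_\alpha<+\infty\}$, so $\lambda_\alpha'$ and $\lambda_\alpha''$ make sense on $(-\xi,\xi)$. *)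

theory Defs
  imports "HOL-Probability.Probability"
begin

definition ext_log :: "ennreal \<Rightarrow> ereal" where
  "ext_log p = (if p = 0 then -\<infinity> else if p = \<infinity> then \<infinity> else ereal (ln (enn2real p)))"

definition lower_semicontinuous :: "('z::topological_space \<Rightarrow> ereal) \<Rightarrow> bool" where
  "lower_semicontinuous I \<longleftrightarrow> (\<forall>c. open {x. c < I x})"

text \<open>
  Sequences of random variables are indexed from 1; the values at index 0 are irrelevant.
  The speed is meant to be positive at every index from 1 on. The infimum over the empty set is
  \<open>\<infinity>\<close>, being taken in \<^typ>\<open>ereal\<close>.
\<close>

definition large_deviations_principle ::
  "'b measure \<Rightarrow> (nat \<Rightarrow> 'b \<Rightarrow> 'z::topological_space) \<Rightarrow> (nat \<Rightarrow> real) \<Rightarrow> ('z \<Rightarrow> ereal) \<Rightarrow> bool"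
where
  "large_deviations_principle N Z v I \<longleftrightarrow>
     (\<forall>n\<ge>1. Z n \<in> borel_measurable N) \<and>
     (\<forall>x. 0 \<le> I x) \<and> lower_semicontinuous I \<and>
     (\<forall>B\<in>sets borel.
        - (INF x\<in>interior B. I x)
          \<le> liminf (\<lambda>n. ereal (1 / v n) * ext_log (emeasure N {\<omega> \<in> space N. Z n \<omega> \<in> B})) \<and>
        liminf (\<lambda>n. ereal (1 / v n) * ext_log (emeasure N {\<omega> \<in> space N. Z n \<omega> \<in> B}))
          \<le> limsup (\<lambda>n. ereal (1 / v n) * ext_log (emeasure N {\<omega> \<in> space N. Z n \<omega> \<in> B})) \<and>
        limsup (\<lambda>n. ereal (1 / v n) * ext_log (emeasure N {\<omega> \<in> space N. Z n \<omega> \<in> B}))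
          \<le> - (INF x\<in>closure B. I x))"

definition phi :: "real \<Rightarrow> real \<Rightarrow> real" where
  "phi \<alpha> x = sgn x * \<bar>x\<bar> powr \<alpha>"

definition lam :: "'a measure \<Rightarrow> ('a \<Rightarrow> real) \<Rightarrow> real \<Rightarrow> real \<Rightarrow> ereal" where
  "lam M X \<alpha> \<eta> = ext_log (\<integral>\<^sup>+ \<omega>. ennreal (exp (\<eta> * phi \<alpha> (X \<omega>))) \<partial>M)"

text \<open>
  The derivatives below are meaningful only in the interior of the domain of finiteness
  of \<^term>\<open>lam M X \<alpha>\<close>, where \<^const>\<open>real_of_ereal\<close> loses no information.
\<close>

definition lam' :: "'a measure \<Rightarrow> ('a \<Rightarrow> real) \<Rightarrow> real \<Rightarrow> real \<Rightarrow> real" where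
  "lam' M X \<alpha> = deriv (\<lambda>\<eta>. real_of_ereal (lam M X \<alpha> \<eta>))"

definition lam'' :: "'a measure \<Rightarrow> ('a \<Rightarrow> real) \<Rightarrow> real \<Rightarrow> real \<Rightarrow> real" where
  "lam'' M X \<alpha> = deriv (lam' M X \<alpha>)"

definition rel_var :: "'a measure \<Rightarrow> ('a \<Rightarrow> real) \<Rightarrow> real \<Rightarrow> real \<Rightarrow> real" where
  "rel_var M X \<alpha> \<eta> = lam'' M X \<alpha> \<eta> / (lam' M X \<alpha> \<eta>)\<^sup>2"

end

theory Submission
  imports Defs "HOL-Real_Asymp.Real_Asymp"
begin

text \<open>
  Put \<open>T = phi \<alpha> (X)\<close>. The sum \<open>Y\<^sub>1 + \<dots> + Y\<^sub>n\<close> exceeds \<open>t = n x\<close> mainly because one summand does.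
  For the upper bound, truncate at \<open>t\<close>: a single summand exceeds \<open>t\<close> with probability at most
  \<open>exp (- \<eta> t\<^sup>\<alpha>)\<close> up to a constant for any \<open>\<eta> < \<xi>\<close>, and the truncated exponential moment at
  \<open>s = \<eta> t\<^sup>\<alpha>\<^sup>-\<^sup>1\<close> is \<open>1 + O(s\<^sup>2)\<close>, because \<open>s x \<le> \<eta> x\<^sup>\<alpha>\<close> on \<open>{0..t}\<close>; here \<open>n s\<^sup>2\<close> is \<open>o(n\<^sup>\<alpha>)\<close>.

  For the lower bound, let \<open>Y\<^sub>1\<close> be of order \<open>n x\<close> and the other summands obey the law of large numbers.
  This needs \<open>T\<close> to charge each window from \<open>u\<close> to \<open>\<rho> u\<close> with probability at least \<open>c exp (- \<xi> \<rho> u)\<close>,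
  where the hypotheses on the relative variance enter. It decreases to a limit \<open>v \<ge> 0\<close>. If \<open>v = 0\<close>,
  Chebyshev's inequality applies to the exponentially tilted law with mean in the middle of the window. If
  \<open>v > 0\<close>, integrating the relative variance, which is minus the derivative of \<open>1 / \<lambda>'\<close>, gives
  \<open>\<lambda>'(\<xi> - s) \<sim> 1 / (v s)\<close>, so the exponential moment varies regularly at \<open>\<xi>\<close> with index \<open>1 / v\<close>, and the
  tilted laws, rescaled, converge to a Gamma distribution, which charges every window.
\<close>

section \<open>Exponential moments and tilting\<close>

lemma exp_Taylor_quadratic: "\<bar>exp y - 1 - y\<bar> \<le> y\<^sup>2 * exp \<bar>y\<bar>" for y :: real
  using Taylor_exp_field[of y 1] by (simp add: power2_eq_square mult.commute algebra_simps)

text \<open>Below \<open>-1\<close> the polynomial already exceeds 1; on \<open>{-1..0}\<close> the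
  constant 3 bounds \<open>exp 1\<close> in the Taylor remainder. This treats negative summands
  without an exponential weight.\<close>

lemma exp_le_quadratic_nonpos:
  fixes y :: real
  assumes "y \<le> 0"
  shows "exp y \<le> 1 + y + 3 * y\<^sup>2"
proof (cases "y < -1")
  case True
  then have "0 \<le> y * (1 + y)" using mult_nonpos_nonpos[of y "1 + y"] by linarith
  then have "0 \<le> y + y\<^sup>2" by (simp add: power2_eq_square distrib_left)
  moreover have "exp y \<le> 1" using assms by simp
  moreover have "0 \<le> y\<^sup>2" by simp
  ultimately show ?thesis by linarith
next
  case False
  have "exp \<bar>y\<bar> \<le> exp 1" using False assms by simp
  also have "\<dots> \<le> (3::real)" by (rule exp_le)
  finally have "y\<^sup>2 * exp \<bar>y\<bar> \<le> y\<^sup>2 * 3" by (intro mult_left_mono) auto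
  then show ?thesis using exp_Taylor_quadratic[of y] by linarith
qed

text \<open>Used to bound \<open>prob A\<close> from below, by exhibiting a minorant of a multiple
  of the indicator whose mean is known.\<close>

lemma (in prob_space) integral_mono_indicator_lower:
  fixes g :: "'a \<Rightarrow> real"
  assumes "integrable M g" "A \<in> events" "\<And>x. x \<in> space M \<Longrightarrow> g x \<le> c * indicator A x"
  shows "expectation g \<le> c * prob A"
proof -
  have "expectation g \<le> expectation (\<lambda>x. c * indicator A x)"
    using assms by (intro integral_mono) (auto intro!: integrable_real_mult_indicator simp: less_top[symmetric])
  then show ?thesis using assms(2) by simp
qed

lemma integral_linear_combination:
  fixes f g h :: "'a \<Rightarrow> real"
  assumes "integrable M f" "integrable M g" "integrable M h"
  shows "(\<integral>x. a * f x + b * g x + c * h x \<partial>M)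
    = a * integral\<^sup>L M f + b * integral\<^sup>L M g + c * integral\<^sup>L M h"
  using assms by simp

section \<open>Smoothness of the moment generating function inside its domain\<close>

locale exp_moments = prob_space M for M :: "'a measure" +
  fixes T :: "'a \<Rightarrow> real" and \<xi> :: real
  assumes T_measurable[measurable]: "T \<in> borel_measurable M"
    and \<xi>_pos: "0 < \<xi>"
    and exp_integrable: "\<And>\<eta>. \<bar>\<eta>\<bar> < \<xi> \<Longrightarrow> integrable M (\<lambda>\<omega>. exp (\<eta> * T \<omega>))"
begin

text \<open>\<open>mom 0\<close> is the moment generating function of \<open>T\<close>, and
  \<open>mom k\<close> turns out to be its \<open>k\<close>-th derivative.\<close>

definition mom :: "nat \<Rightarrow> real \<Rightarrow> real" where
  "mom k \<eta> = expectation (\<lambda>\<omega>. T \<omega> ^ k * exp (\<eta> * T \<omega>))"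

text \<open>Half of the gap to \<xi> is spent as \<open>q\<close>: one term of the exponential
  series bounds the power by a multiple of \<open>exp (q * \<bar>T \<omega>\<bar>)\<close>, and the
  absolute value in the exponent is removed by adding the exponentials for both signs. The parameter
  \<open>r\<close> leaves room for a Taylor remainder.\<close>

lemma abs_moment_integrable:
  assumes "0 \<le> r" "\<bar>\<eta>\<bar> + r < \<xi>"
  shows "integrable M (\<lambda>\<omega>. \<bar>T \<omega>\<bar> ^ k * exp (\<eta> * T \<omega> + r * \<bar>T \<omega>\<bar>))"
proof -
  define q where "q = (\<xi> - (\<bar>\<eta>\<bar> + r)) / 2"
  have q: "0 < q" "\<bar>\<eta>\<bar> + (r + q) < \<xi>" using assms by (simp_all add: q_def field_simps)
  have "integrable M (\<lambda>\<omega>. exp ((\<eta> + (r + q)) * T \<omega>) + exp ((\<eta> - (r + q)) * T \<omega>))"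
    using q assms by (intro Bochner_Integration.integrable_add exp_integrable) auto
  then have "integrable M (\<lambda>\<omega>. (fact k / q ^ k) * (exp ((\<eta> + (r + q)) * T \<omega>) + exp ((\<eta> - (r + q)) * T \<omega>)))"
    by simp
  then show ?thesis
  proof (rule Bochner_Integration.integrable_bound)
    show "AE \<omega> in M. norm (\<bar>T \<omega>\<bar> ^ k * exp (\<eta> * T \<omega> + r * \<bar>T \<omega>\<bar>))
        \<le> norm (fact k / q ^ k * (exp ((\<eta> + (r + q)) * T \<omega>) + exp ((\<eta> - (r + q)) * T \<omega>)))"
    proof (rule AE_I2)
      fix \<omega>
      have "(q * \<bar>T \<omega>\<bar>) ^ k / fact k \<le> (\<Sum>i<Suc k. (q * \<bar>T \<omega>\<bar>) ^ i / fact i)"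
        using q(1) by (intro member_le_sum) auto
      also have "\<dots> \<le> exp (q * \<bar>T \<omega>\<bar>)"
        using q(1) Maclaurin_exp_le[of "q * \<bar>T \<omega>\<bar>" "Suc k"] by fastforce
      finally have "(q * \<bar>T \<omega>\<bar>) ^ k / fact k \<le> exp (q * \<bar>T \<omega>\<bar>)" .
      then have "\<bar>T \<omega>\<bar> ^ k \<le> fact k / q ^ k * exp (q * \<bar>T \<omega>\<bar>)"
        using q(1) by (simp add: power_mult_distrib field_simps)
      then have "\<bar>T \<omega>\<bar> ^ k * exp (\<eta> * T \<omega> + r * \<bar>T \<omega>\<bar>)
          \<le> (fact k / q ^ k * exp (q * \<bar>T \<omega>\<bar>)) * exp (\<eta> * T \<omega> + r * \<bar>T \<omega>\<bar>)"
        by (intro mult_right_mono) auto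
      also have "\<dots> = fact k / q ^ k * exp (\<eta> * T \<omega> + (r + q) * \<bar>T \<omega>\<bar>)"
        by (simp add: mult_exp_exp algebra_simps)
      also have "exp (\<eta> * T \<omega> + (r + q) * \<bar>T \<omega>\<bar>)
          \<le> exp ((\<eta> + (r + q)) * T \<omega>) + exp ((\<eta> - (r + q)) * T \<omega>)"
        by (cases "0 \<le> T \<omega>") (auto simp: algebra_simps)
      finally show "norm (\<bar>T \<omega>\<bar> ^ k * exp (\<eta> * T \<omega> + r * \<bar>T \<omega>\<bar>))
        \<le> norm (fact k / q ^ k * (exp ((\<eta> + (r + q)) * T \<omega>) + exp ((\<eta> - (r + q)) * T \<omega>)))"
        using q(1) by (simp add: abs_mult divide_right_mono mult_left_mono add_nonneg_nonneg)
    qed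
  qed auto
qed

lemma moment_integrable:
  assumes "\<bar>\<eta>\<bar> < \<xi>"
  shows "integrable M (\<lambda>\<omega>. T \<omega> ^ k * exp (\<eta> * T \<omega>))"
proof -
  have "integrable M (\<lambda>\<omega>. \<bar>T \<omega>\<bar> ^ k * exp (\<eta> * T \<omega>))"
    using abs_moment_integrable[of 0 \<eta> k] assms by simp
  then show ?thesis
    by (rule Bochner_Integration.integrable_bound) (auto simp: power_abs abs_mult)
qed

text \<open>Differentiation under the integral with an explicit error: the second-order remainder of
  \<open>exp (h * T \<omega>)\<close> is dominated uniformly for
  \<open>\<bar>h\<bar> \<le> r\<close>, so the difference quotient is off by at most a constant
  times \<open>\<bar>h\<bar>\<close>.\<close>

lemma mom_has_derivative:
  assumes "\<bar>\<eta>\<bar> < \<xi>"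
  shows "(mom k has_field_derivative mom (Suc k) \<eta>) (at \<eta>)"
proof -
  define r where "r = (\<xi> - \<bar>\<eta>\<bar>) / 2"
  have r: "0 < r" "\<bar>\<eta>\<bar> + r < \<xi>" using assms by (simp_all add: r_def field_simps)
  define C where "C = expectation (\<lambda>\<omega>. \<bar>T \<omega>\<bar> ^ (k + 2) * exp (\<eta> * T \<omega> + r * \<bar>T \<omega>\<bar>))"
  have bound: "\<bar>(mom k (\<eta> + h) - mom k \<eta>) / h - mom (Suc k) \<eta>\<bar> \<le> \<bar>h\<bar> * C" if h: "h \<noteq> 0" "\<bar>h\<bar> \<le> r" for h
  proof -
    have "\<bar>\<eta> + h\<bar> < \<xi>" using h r by linarith
    note int = moment_integrable[OF this, of k] moment_integrable[OF assms, of k] moment_integrable[OF assms, of "Suc k"]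
    define d where "d \<omega> = T \<omega> ^ k * exp ((\<eta> + h) * T \<omega>) - T \<omega> ^ k * exp (\<eta> * T \<omega>)
        - h * (T \<omega> ^ Suc k * exp (\<eta> * T \<omega>))" for \<omega>
    have "mom k (\<eta> + h) - mom k \<eta> - h * mom (Suc k) \<eta>
        = 1 * mom k (\<eta> + h) + (- 1) * mom k \<eta> + (- h) * mom (Suc k) \<eta>"
      by (simp only: mult_1 mult_minus_left diff_conv_add_uminus)
    also have "\<dots> = expectation (\<lambda>\<omega>. 1 * (T \<omega> ^ k * exp ((\<eta> + h) * T \<omega>)) + (- 1) * (T \<omega> ^ k * exp (\<eta> * T \<omega>))
        + (- h) * (T \<omega> ^ Suc k * exp (\<eta> * T \<omega>)))"
      unfolding mom_def by (rule integral_linear_combination[OF int, symmetric])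
    also have "\<dots> = expectation d"
      unfolding d_def by (simp only: mult_1 mult_minus_left diff_conv_add_uminus)
    finally have "\<bar>mom k (\<eta> + h) - mom k \<eta> - h * mom (Suc k) \<eta>\<bar> = \<bar>expectation d\<bar>"
      by (rule arg_cong)
    also have "\<dots> \<le> expectation (\<lambda>\<omega>. \<bar>d \<omega>\<bar>)"
      by (rule integral_abs_bound)
    also have "\<dots> \<le> expectation (\<lambda>\<omega>. h\<^sup>2 * (\<bar>T \<omega>\<bar> ^ (k + 2) * exp (\<eta> * T \<omega> + r * \<bar>T \<omega>\<bar>)))"
    proof (rule integral_mono)
      show "integrable M (\<lambda>\<omega>. \<bar>d \<omega>\<bar>)"
        unfolding d_def by (rule integrable_abs Bochner_Integration.integrable_diff int integrable_mult_right impI)+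
      show "integrable M (\<lambda>\<omega>. h\<^sup>2 * (\<bar>T \<omega>\<bar> ^ (k + 2) * exp (\<eta> * T \<omega> + r * \<bar>T \<omega>\<bar>)))"
        by (rule integrable_mult_right impI abs_moment_integrable less_imp_le r)+
      fix \<omega>
      have "d \<omega>
         = T \<omega> ^ k * exp (\<eta> * T \<omega>) * (exp (h * T \<omega>) - 1 - h * T \<omega>)"
        by (simp add: d_def algebra_simps exp_add)
      then have "\<bar>d \<omega>\<bar> = \<bar>T \<omega>\<bar> ^ k * exp (\<eta> * T \<omega>) * \<bar>exp (h * T \<omega>) - 1 - h * T \<omega>\<bar>"
        by (simp add: abs_mult power_abs)
      also have "\<dots> \<le> \<bar>T \<omega>\<bar> ^ k * exp (\<eta> * T \<omega>) * ((h * T \<omega>)\<^sup>2 * exp (r * \<bar>T \<omega>\<bar>))"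
      proof (intro mult_left_mono order_trans[OF exp_Taylor_quadratic])
        show "exp \<bar>h * T \<omega>\<bar> \<le> exp (r * \<bar>T \<omega>\<bar>)"
          using h by (simp add: abs_mult mult_right_mono)
      qed auto
      also have "\<dots> = h\<^sup>2 * (\<bar>T \<omega>\<bar> ^ (k + 2) * exp (\<eta> * T \<omega> + r * \<bar>T \<omega>\<bar>))"
        by (simp add: exp_add power_mult_distrib power_add power2_eq_square)
      finally show "\<bar>d \<omega>\<bar> \<le> h\<^sup>2 * (\<bar>T \<omega>\<bar> ^ (k + 2) * exp (\<eta> * T \<omega> + r * \<bar>T \<omega>\<bar>))" .
    qed
    also have "\<dots> = h\<^sup>2 * C" by (simp add: C_def)
    finally have "\<bar>mom k (\<eta> + h) - mom k \<eta> - h * mom (Suc k) \<eta>\<bar> / \<bar>h\<bar> \<le> h\<^sup>2 * C / \<bar>h\<bar>"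
      by (intro divide_right_mono) auto
    moreover have "h\<^sup>2 * C / \<bar>h\<bar> = \<bar>h\<bar> * C"
      using h by (simp add: power2_eq_square abs_if)
    moreover have "\<bar>mom k (\<eta> + h) - mom k \<eta> - h * mom (Suc k) \<eta>\<bar> / \<bar>h\<bar>
        = \<bar>(mom k (\<eta> + h) - mom k \<eta>) / h - mom (Suc k) \<eta>\<bar>"
      using h by (simp flip: abs_divide add: diff_divide_distrib)
    ultimately show ?thesis by simp
  qed
  have "((\<lambda>h. (mom k (\<eta> + h) - mom k \<eta>) / h - mom (Suc k) \<eta>) \<longlongrightarrow> 0) (at 0)"
  proof (rule Lim_null_comparison)
    show "\<forall>\<^sub>F h in at 0. norm ((mom k (\<eta> + h) - mom k \<eta>) / h - mom (Suc k) \<eta>) \<le> \<bar>h\<bar> * C"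
      unfolding eventually_at using r(1) by (intro exI[of _ r]) (auto intro!: bound)
    show "((\<lambda>h. \<bar>h\<bar> * C) \<longlongrightarrow> 0) (at 0)" by (auto intro!: tendsto_eq_intros)
  qed
  then show ?thesis
    unfolding DERIV_def by (rule LIM_zero_cancel)
qed

lemma mom_pos: "0 < mom 0 \<eta>" if "\<bar>\<eta>\<bar> < \<xi>"
proof -
  have "0 < expectation (\<lambda>\<omega>. exp (\<eta> * T \<omega>))"
    using exp_integrable[OF that]
    by (subst integral_less_AE_space[of "\<lambda>_. 0", simplified]) (auto simp: emeasure_space_1)
  then show ?thesis by (simp add: mom_def)
qed

text \<open>Mean, variance and relative variance of the exponentially tilted law of \<open>T\<close>.\<close>

definition tmean :: "real \<Rightarrow> real" where "tmean \<eta> = mom 1 \<eta> / mom 0 \<eta>"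

definition tvar :: "real \<Rightarrow> real" where "tvar \<eta> = mom 2 \<eta> / mom 0 \<eta> - (tmean \<eta>)\<^sup>2"

definition trel :: "real \<Rightarrow> real" where "trel \<eta> = tvar \<eta> / (tmean \<eta>)\<^sup>2"

lemma ln_mom_has_derivative:
  assumes "\<bar>\<eta>\<bar> < \<xi>"
  shows "((\<lambda>\<eta>. ln (mom 0 \<eta>)) has_field_derivative tmean \<eta>) (at \<eta>)"
  using mom_pos[OF assms] mom_has_derivative[OF assms, of 0] unfolding tmean_def
  by (auto intro!: derivative_eq_intros)

lemma tmean_has_derivative:
  assumes "\<bar>\<eta>\<bar> < \<xi>"
  shows "(tmean has_field_derivative tvar \<eta>) (at \<eta>)"
  using mom_pos[OF assms] mom_has_derivative[OF assms, of 0] mom_has_derivative[OF assms, of 1]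
  unfolding tmean_def[abs_def] tvar_def
  by (auto intro!: derivative_eq_intros simp: field_simps power2_eq_square eval_nat_numeral)

text \<open>Shows that the derivative of \<open>tmean\<close> is a genuine variance under the tilted
  law; \<open>mom 0 \<eta>\<close> is the normalising factor.\<close>

lemma tvar_eq:
  assumes "\<bar>\<eta>\<bar> < \<xi>"
  shows "expectation (\<lambda>\<omega>. (T \<omega> - tmean \<eta>)\<^sup>2 * exp (\<eta> * T \<omega>)) = tvar \<eta> * mom 0 \<eta>"
proof -
  let ?m = "tmean \<eta>"
  have "expectation (\<lambda>\<omega>. (T \<omega> - ?m)\<^sup>2 * exp (\<eta> * T \<omega>))
      = expectation (\<lambda>\<omega>. 1 * (T \<omega> ^ 2 * exp (\<eta> * T \<omega>)) + (- 2 * ?m) * (T \<omega> ^ 1 * exp (\<eta> * T \<omega>)) + ?m\<^sup>2 * (T \<omega> ^ 0 * exp (\<eta> * T \<omega>)))"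
    by (intro Bochner_Integration.integral_cong) (auto simp: algebra_simps power2_eq_square)
  also have "\<dots> = 1 * mom 2 \<eta> + (- 2 * ?m) * mom 1 \<eta> + ?m\<^sup>2 * mom 0 \<eta>"
    unfolding mom_def by (rule integral_linear_combination moment_integrable assms)+
  also have "\<dots> = tvar \<eta> * mom 0 \<eta>"
    using mom_pos[OF assms] by (simp add: tvar_def tmean_def field_simps power2_eq_square)
  finally show ?thesis .
qed

lemma tvar_nonneg:
  assumes "\<bar>\<eta>\<bar> < \<xi>"
  shows "0 \<le> tvar \<eta>"
proof -
  have "0 \<le> expectation (\<lambda>\<omega>. (T \<omega> - tmean \<eta>)\<^sup>2 * exp (\<eta> * T \<omega>))" by simp
  then show ?thesis using tvar_eq[OF assms] mom_pos[OF assms] by (simp add: zero_le_mult_iff)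
qed

lemma trel_nonneg: "\<bar>\<eta>\<bar> < \<xi> \<Longrightarrow> 0 \<le> trel \<eta>"
  by (simp add: trel_def tvar_nonneg)

text \<open>For nonnegative \<eta>, weighting by \<open>exp (\<eta> * T \<omega>)\<close> can only
  raise \<open>T\<close> pointwise, whatever its sign. This later removes the absolute value from
  the steepness hypothesis.\<close>

lemma tmean_nonneg:
  assumes "integrable M T" "expectation T = 0" "0 \<le> \<eta>" "\<eta> < \<xi>"
  shows "0 \<le> tmean \<eta>"
proof -
  have \<eta>: "\<bar>\<eta>\<bar> < \<xi>" using assms by simp
  have "expectation T \<le> mom 1 \<eta>" unfolding mom_def
  proof (rule integral_mono[OF assms(1) moment_integrable[OF \<eta>]])
    fix \<omega>
    show "T \<omega> \<le> T \<omega> ^ 1 * exp (\<eta> * T \<omega>)"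
    proof (cases "0 \<le> T \<omega>")
      case True
      then have "T \<omega> * 1 \<le> T \<omega> * exp (\<eta> * T \<omega>)" using assms(3) by (intro mult_left_mono) auto
      then show ?thesis by simp
    next
      case False
      then have "T \<omega> * 1 \<le> T \<omega> * exp (\<eta> * T \<omega>)"
        using assms(3) by (intro mult_left_mono_neg) (auto simp: mult_nonneg_nonpos)
      then show ?thesis by simp
    qed
  qed
  then show ?thesis using assms(2) mom_pos[OF \<eta>] by (simp add: tmean_def)
qed

end

section \<open>Probability of windows\<close>

text \<open>The Laplace transform of the Gamma law of shape \<open>p\<close> at the integer
  \<open>j\<close>, obtained by substituting \<open>(1 + j) * t\<close> in the Gamma
  integral.\<close>

lemma gamma_exp_moment:
  fixes p :: real
  assumes "0 < p"
  shows "has_bochner_integral lborel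
    (\<lambda>t. (indicator {0..} t * t powr (p - 1) * exp (- t) / Gamma p) * exp (- t) ^ j) ((1 + real j) powr - p)"
proof -
  let ?f = "\<lambda>t::real. indicator {0..} t * t powr (p - 1) / exp t"
  let ?c = "1 + real j"
  have G: "0 < Gamma p" using assms by (rule Gamma_real_pos)
  have "has_bochner_integral lborel ?f (Gamma p)"
    using Gamma_conv_nn_integral_real[OF assms] G
    by (intro has_bochner_integral_nn_integral) auto
  then have "has_bochner_integral lborel (\<lambda>t. ?f (0 + ?c * t)) (Gamma p /\<^sub>R \<bar>?c\<bar>)"
    by (subst (asm) lborel_has_bochner_integral_real_affine_iff[where c = ?c and t = 0]) auto
  then have "has_bochner_integral lborel (\<lambda>t. (?c powr (1 - p) / Gamma p) * ?f (0 + ?c * t))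
      ((?c powr (1 - p) / Gamma p) * (Gamma p /\<^sub>R \<bar>?c\<bar>))"
    by (intro has_bochner_integral_mult_right)
  moreover have "(?c powr (1 - p) / Gamma p) * ?f (0 + ?c * t)
      = (indicator {0..} t * t powr (p - 1) * exp (- t) / Gamma p) * exp (- t) ^ j" for t
  proof (cases "0 \<le> t")
    case True
    then have "(?c * t) powr (p - 1) = ?c powr (p - 1) * t powr (p - 1)"
      by (simp add: powr_mult)
    moreover have "?c powr (1 - p) * ?c powr (p - 1) = 1"
      by (simp flip: powr_add)
    moreover have "exp (- (?c * t)) = exp (- t) * exp (- t) ^ j"
      unfolding exp_of_nat_mult[symmetric] exp_add[symmetric] by (simp add: algebra_simps)
    moreover have "inverse (exp (?c * t)) = exp (- (?c * t))" by (simp add: exp_minus)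
    ultimately show ?thesis
      using True G by (simp add: divide_inverse mult.assoc mult.left_commute) 
  next
    case False
    then have "\<not> 0 \<le> ?c * t" by (simp add: zero_le_mult_iff)
    with False show ?thesis by simp
  qed
  moreover have "(c powr (1 - p) / Gamma p) * (Gamma p /\<^sub>R \<bar>c\<bar>) = c powr - p" if "0 < c" for c
    using G that by (simp add: powr_diff powr_minus field_simps)
  then have "(?c powr (1 - p) / Gamma p) * (Gamma p /\<^sub>R \<bar>?c\<bar>) = ?c powr - p" by simp
  ultimately show ?thesis by simp
qed

text \<open>With explicit coefficients, the mean of the approximant becomes a finite combination of
  Laplace transforms.\<close>

lemma Bernstein_poly: "\<exists>P :: real poly. \<forall>x. poly P x = (\<Sum>k\<le>n. f (k / n) * Bernstein n k x)"
proof -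
  define P :: "real poly" where
    "P = (\<Sum>k\<le>n. smult (f (k / n) * of_nat (n choose k)) (monom 1 k * [:1, - 1:] ^ (n - k)))"
  have "\<forall>x. poly P x = (\<Sum>k\<le>n. f (k / n) * Bernstein n k x)"
    by (auto simp: P_def Bernstein_def poly_sum poly_monom poly_power algebra_simps intro!: sum.cong)
  then show ?thesis by blast
qed

text \<open>The sum in the last claim is the mean of \<open>poly P (exp (- t))\<close> under the Gamma distribution
  with shape \<open>p\<close>: \<open>P\<close> comes from Bernstein approximation of a continuous bump supported in the window.\<close>

lemma exp_poly_bump:
  fixes p \<rho> :: real
  assumes "0 < p" "1 < \<rho>"
  obtains P :: "real poly" and \<kappa> where "0 < \<kappa>"
    "\<And>t. 0 \<le> t \<Longrightarrow> poly P (exp (- t)) \<le> indicator {1<..<\<rho>} t"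
    "\<kappa> \<le> (\<Sum>j\<le>degree P. coeff P j * (1 + real j) powr - p)"
proof -
  define h where "h t = indicator {0..} t * t powr (p - 1) * exp (- t) / Gamma p" for t :: real
  have G: "0 < Gamma p" using assms(1) by (rule Gamma_real_pos)
  have h_nonneg: "0 \<le> h t" for t using G by (simp add: h_def)
  have hint: "has_bochner_integral lborel (\<lambda>t. h t * exp (- t) ^ j) ((1 + real j) powr - p)" for j
    unfolding h_def by (rule gamma_exp_moment[OF assms(1)])
  have h1: "integrable lborel h" "integral\<^sup>L lborel h = 1"
    using hint[of 0] by (auto simp: has_bochner_integral_iff)
  have hP: "has_bochner_integral lborel (\<lambda>t. h t * poly Q (exp (- t)))
      (\<Sum>j\<le>degree Q. coeff Q j * (1 + real j) powr - p)" for Q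
  proof -
    have "has_bochner_integral lborel (\<lambda>t. \<Sum>j\<le>degree Q. coeff Q j * (h t * exp (- t) ^ j))
      (\<Sum>j\<le>degree Q. coeff Q j * (1 + real j) powr - p)"
      by (intro has_bochner_integral_sum has_bochner_integral_mult_right hint)
    then show ?thesis by (simp add: poly_altdef sum_distrib_left algebra_simps)
  qed
  \<comment> \<open>A tent in the variable \<open>q = exp (- t)\<close>, positive exactly when
    \<open>t\<close> lies strictly between 1 and \<rho>.\<close>
  define F where "F q = max 0 (min (q - exp (- \<rho>)) (exp (- 1) - q))" for q :: real
  have F_cont: "continuous_on S F" for S unfolding F_def by (intro continuous_intros)
  have F_meas[measurable]: "F \<in> borel_measurable borel"
    by (intro borel_measurable_continuous_onI F_cont)
  have F_bounds: "0 \<le> F q" "q \<le> 1 \<Longrightarrow> F q \<le> 1" for q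
    using exp_gt_zero[of "- \<rho>"] by (auto simp: F_def simp del: exp_gt_zero)
  have F_le: "F (exp (- t)) \<le> indicator {1<..<\<rho>} t" if "0 \<le> t" for t
    using F_bounds(2)[of "exp (- t)"] that by (auto simp: F_def indicator_def min_le_iff_disj)
  have hm[measurable]: "h \<in> borel_measurable lborel" using h1(1) by auto
  have hF: "integrable lborel (\<lambda>t. h t * F (exp (- t)))"
  proof (rule Bochner_Integration.integrable_bound[OF h1(1)])
    show "AE t in lborel. norm (h t * F (exp (- t))) \<le> norm (h t)"
    proof (rule AE_I2)
      fix t show "norm (h t * F (exp (- t))) \<le> norm (h t)"
        using F_bounds(1)[of "exp (- t)"] F_bounds(2)[of "exp (- t)"] h_nonneg[of t]
          mult_left_le[of "F (exp (- t))" "h t"]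
        by (cases "0 \<le> t") (auto simp: abs_mult, simp add: h_def)
    qed
  qed measurable
  \<comment> \<open>A quarter of the mean of the tent: one \<kappa> is lost to the Bernstein error,
    one to the downward shift, and two remain.\<close>
  define \<kappa> where "\<kappa> = (LINT t|lborel. h t * F (exp (- t))) / 4"
  have "(LINT t|lborel. h t * F (exp (- t))) \<noteq> 0"
  proof
    assume "(LINT t|lborel. h t * F (exp (- t))) = 0"
    then have "AE t in lborel. h t * F (exp (- t)) = 0"
      using h_nonneg F_bounds(1) by (subst (asm) integral_nonneg_eq_0_iff_AE[OF hF]) auto
    moreover have "h t * F (exp (- t)) \<noteq> 0" if t: "t \<in> {1<..<\<rho>}" for t
    proof -
      have "0 < h t" "0 < F (exp (- t))" using t G by (auto simp: h_def F_def)
      then show ?thesis by simp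
    qed
    ultimately have "AE t in lborel. t \<notin> {1<..<\<rho>}"
      by (auto elim!: eventually_mono)
    then have "emeasure lborel {1<..<\<rho>} = 0"
      by (subst (asm) AE_iff_measurable[where N = "{1<..<\<rho>}"]) auto
    then show False using assms(2) by simp
  qed
  moreover have "0 \<le> (LINT t|lborel. h t * F (exp (- t)))"
    using h_nonneg F_bounds(1) by (intro Bochner_Integration.integral_nonneg) auto
  ultimately have \<kappa>: "0 < \<kappa>" by (simp add: \<kappa>_def)
  from Bernstein_Weierstrass[OF F_cont \<kappa>] obtain n where
    n: "\<And>x. x \<in> {0..1} \<Longrightarrow> \<bar>F x - (\<Sum>k\<le>n. F (k / n) * Bernstein n k x)\<bar> < \<kappa>" by blast
  obtain Q :: "real poly" where Q: "\<And>x. poly Q x = (\<Sum>k\<le>n. F (k / n) * Bernstein n k x)"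
    using Bernstein_poly[of F n] by blast
  have QF: "\<bar>F (exp (- t)) - poly Q (exp (- t))\<bar> < \<kappa>" if "0 \<le> t" for t
    using n[of "exp (- t)"] that by (simp add: Q)
  \<comment> \<open>The shift by the approximation error puts \<open>P\<close> below the tent, hence
    below the indicator of the window.\<close>
  define P where "P = Q - [:\<kappa>:]"
  have "(LINT t|lborel. h t * F (exp (- t)) - (2 * \<kappa>) * h t) \<le> (LINT t|lborel. h t * poly P (exp (- t)))"
  proof (rule integral_mono)
    fix t show "h t * F (exp (- t)) - (2 * \<kappa>) * h t \<le> h t * poly P (exp (- t))"
    proof (cases "0 \<le> t")
      case True
      then have "h t * (F (exp (- t)) - 2 * \<kappa>) \<le> h t * poly P (exp (- t))"
        using QF[of t] h_nonneg[of t] by (intro mult_left_mono) (auto simp: P_def)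
      then show ?thesis by (simp add: algebra_simps)
    qed (simp add: h_def)
  qed (use hF h1 hP[of P] in \<open>auto simp: has_bochner_integral_iff\<close>)
  also have "(LINT t|lborel. h t * F (exp (- t)) - (2 * \<kappa>) * h t) = 4 * \<kappa> - 2 * \<kappa>"
    using hF h1 by (simp add: \<kappa>_def)
  finally have "2 * \<kappa> \<le> (\<Sum>j\<le>degree P. coeff P j * (1 + real j) powr - p)"
    using hP[of P] by (simp add: has_bochner_integral_iff)
  moreover have "poly P (exp (- t)) \<le> indicator {1<..<\<rho>} t" if "0 \<le> t" for t
    using QF[OF that] F_le[OF that] by (simp add: P_def)
  ultimately show ?thesis using that[of "2 * \<kappa>" P] \<kappa> by simp
qed

section \<open>Tilted laws near the right endpoint of the domain\<close>

text \<open>Steepness is stated as unboundedness of \<open>tmean\<close> near \<xi>; as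
  \<open>tmean\<close> is monotone, this amounts to divergence.\<close>

locale steep_moments = exp_moments +
  fixes \<xi>\<^sub>0 :: real
  assumes T_integrable: "integrable M T"
    and T_mean: "expectation T = 0"
    and \<xi>\<^sub>0: "0 < \<xi>\<^sub>0" "\<xi>\<^sub>0 < \<xi>"
    and trel_antimono: "antimono_on {\<xi>\<^sub>0..<\<xi>} trel"
    and tmean_unbounded: "\<And>K a. a < \<xi> \<Longrightarrow> \<exists>\<eta>. a < \<eta> \<and> \<eta> < \<xi> \<and> K < tmean \<eta>"
begin

text \<open>From \<open>1 + y \<le> exp y\<close> and the centring of \<open>T\<close>. It lets the
  normalising factor be dropped in lower bounds.\<close>

lemma mom_ge_1:
  assumes "0 \<le> \<eta>" "\<eta> < \<xi>"
  shows "1 \<le> mom 0 \<eta>"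
proof -
  have "expectation (\<lambda>\<omega>. 1 + \<eta> * T \<omega>) \<le> expectation (\<lambda>\<omega>. exp (\<eta> * T \<omega>))"
    using T_integrable exp_integrable[of \<eta>] assms by (intro integral_mono) auto
  then show ?thesis using T_integrable T_mean by (simp add: mom_def prob_space)
qed

lemma tmean_mono:
  assumes "\<bar>a\<bar> < \<xi>" "\<bar>b\<bar> < \<xi>" "a \<le> b"
  shows "tmean a \<le> tmean b"
proof (rule DERIV_nonneg_imp_nondecreasing[OF assms(3)])
  fix x assume "a \<le> x" "x \<le> b"
  then have "\<bar>x\<bar> < \<xi>" using assms by linarith
  then show "\<exists>y. (tmean has_real_derivative y) (at x) \<and> 0 \<le> y"
    using tmean_has_derivative tvar_nonneg by blast
qed

text \<open>The limit \<open>v\<close> of the relative variance; by monotonicity the infimum is the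
  left limit at \<xi>.\<close>

definition trel_limit :: real where "trel_limit = Inf (trel ` {\<xi>\<^sub>0..<\<xi>})"

lemma trel_bdd_below: "bdd_below (trel ` {\<xi>\<^sub>0..<\<xi>})"
  using trel_nonneg \<xi>\<^sub>0 by (intro bdd_belowI[of _ 0]) auto

lemma trel_limit_nonneg: "0 \<le> trel_limit"
  unfolding trel_limit_def using trel_nonneg \<xi>\<^sub>0 by (intro cInf_greatest) auto

lemma trel_limit_le: "\<xi>\<^sub>0 \<le> \<eta> \<Longrightarrow> \<eta> < \<xi> \<Longrightarrow> trel_limit \<le> trel \<eta>"
  unfolding trel_limit_def using trel_bdd_below by (intro cInf_lower) auto

lemma trel_tendsto: "(trel \<longlongrightarrow> trel_limit) (at_left \<xi>)"
proof (rule order_tendstoI)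
  fix a assume a: "a < trel_limit"
  show "\<forall>\<^sub>F \<eta> in at_left \<xi>. a < trel \<eta>"
    using eventually_at_left_real[OF \<xi>\<^sub>0(2)]
    by eventually_elim (use a trel_limit_le in \<open>force intro: less_le_trans\<close>)
next
  fix a assume "trel_limit < a"
  then obtain \<eta>\<^sub>1 where \<eta>\<^sub>1: "\<xi>\<^sub>0 \<le> \<eta>\<^sub>1" "\<eta>\<^sub>1 < \<xi>" "trel \<eta>\<^sub>1 < a"
    unfolding trel_limit_def using \<xi>\<^sub>0(2) by (subst (asm) cInf_less_iff) (auto simp: trel_bdd_below)
  show "\<forall>\<^sub>F \<eta> in at_left \<xi>. trel \<eta> < a"
    using eventually_at_left_real[OF \<eta>\<^sub>1(2)]
  proof eventually_elim
    case (elim \<eta>)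
    then have "trel \<eta> \<le> trel \<eta>\<^sub>1"
      using \<eta>\<^sub>1 by (intro monotone_onD[OF trel_antimono]) auto
    then show ?case using \<eta>\<^sub>1(3) by simp
  qed
qed

text \<open>Undoes the tilt: on the window the weight \<open>exp (\<eta> * T \<omega>)\<close> is at
  most \<open>exp (\<xi> * \<rho> * u)\<close>. It then suffices to find a minorant \<open>f\<close>
  of the weighted indicator with mean at least \<open>c\<close>.\<close>

lemma prob_window_ge:
  assumes "0 \<le> \<eta>" "\<eta> < \<xi>" "0 < u" "0 < \<rho>"
    and "integrable M f" "c \<le> expectation f"
    and f: "\<And>\<omega>. \<omega> \<in> space M \<Longrightarrow> f \<omega> \<le> (if u < T \<omega> \<and> T \<omega> < \<rho> * u then exp (\<eta> * T \<omega>) else 0)"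
  shows "c * exp (- (\<xi> * \<rho> * u)) \<le> prob {\<omega> \<in> space M. u < T \<omega> \<and> T \<omega> < \<rho> * u}"
proof -
  let ?A = "{\<omega> \<in> space M. u < T \<omega> \<and> T \<omega> < \<rho> * u}"
  have "expectation f \<le> exp (\<xi> * \<rho> * u) * prob ?A"
  proof (rule integral_mono_indicator_lower[OF assms(5)])
    fix \<omega> assume \<omega>: "\<omega> \<in> space M"
    have "exp (\<eta> * T \<omega>) \<le> exp (\<xi> * \<rho> * u)" if "u < T \<omega>" "T \<omega> < \<rho> * u"
    proof -
      have "\<eta> * T \<omega> \<le> \<xi> * (\<rho> * u)"
        using that assms by (intro mult_mono) auto
      then show ?thesis by (simp add: mult.assoc)
    qed
    then show "f \<omega> \<le> exp (\<xi> * \<rho> * u) * indicator ?A \<omega>"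
      using f[OF \<omega>] \<omega> by (auto simp: indicator_def split: if_splits intro: order_trans)
  qed simp
  then have "c \<le> exp (\<xi> * \<rho> * u) * prob ?A" using assms(6) by simp
  then show ?thesis by (simp add: exp_minus field_simps)
qed

text \<open>Tilt so that the mean is the midpoint \<open>m\<close> of the window. A small relative
  variance makes the standard deviation small against the half-width \<open>d\<close>, and
  Chebyshev's inequality keeps half of the mass.\<close>

lemma window_concentrated:
  assumes "trel_limit = 0" "1 < \<rho>"
  shows "\<forall>\<^sub>F u in at_top. 1 / 2 * exp (- (\<xi> * \<rho> * u)) \<le> prob {\<omega> \<in> space M. u < T \<omega> \<and> T \<omega> < \<rho> * u}"
proof -
  \<comment> \<open>Chosen so that \<open>\<epsilon> * m\<^sup>2 = d\<^sup>2 / 2\<close> for every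
    \<open>u\<close>.\<close>
  define \<epsilon> where "\<epsilon> = (\<rho> - 1)\<^sup>2 / (2 * (1 + \<rho>)\<^sup>2)"
  have "0 < \<epsilon>" using assms(2) by (simp add: \<epsilon>_def)
  then have "\<forall>\<^sub>F \<eta> in at_left \<xi>. trel \<eta> < \<epsilon>"
    using trel_tendsto assms(1) by (auto dest: order_tendstoD)
  then obtain a where a: "a < \<xi>" "\<And>\<eta>. a < \<eta> \<Longrightarrow> \<eta> < \<xi> \<Longrightarrow> trel \<eta> < \<epsilon>"
    using \<xi>\<^sub>0 by (auto simp: eventually_at_left[of 0])
  define b where "b = (max a 0 + \<xi>) / 2"
  have b: "a < b" "0 < b" "b < \<xi>" using a(1) \<xi>_pos by (auto simp: b_def field_simps max_def)
  show ?thesis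
    using eventually_gt_at_top[of 0] eventually_gt_at_top[of "tmean b"]
  proof eventually_elim
    case (elim u)
    define m where "m = (1 + \<rho>) / 2 * u"
    define d where "d = (\<rho> - 1) / 2 * u"
    have d: "0 < d" using elim assms(2) by (simp add: d_def)
    have "tmean b < u" by (fact elim)
    also have "u < m" using elim assms(2) by (simp add: m_def field_simps)
    finally have bm: "tmean b < m" .
    obtain b' where b': "b < b'" "b' < \<xi>" "m < tmean b'" using tmean_unbounded[OF b(3)] by blast
    \<comment> \<open>Starting the search at \<open>b\<close> forces \<eta> beyond \<open>a\<close>,
      where the relative variance is below \<epsilon>; this is why \<open>u\<close> must exceed
      \<open>tmean b\<close>.\<close>
    have "\<exists>\<eta>\<ge>b. \<eta> \<le> b' \<and> tmean \<eta> = m"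
    proof (rule IVT)
      show "\<forall>x. b \<le> x \<and> x \<le> b' \<longrightarrow> isCont tmean x"
        using b b' by (intro allI impI DERIV_isCont[OF tmean_has_derivative]) auto
    qed (use bm b' in auto)
    then obtain \<eta> where \<eta>: "b \<le> \<eta>" "\<eta> \<le> b'" "tmean \<eta> = m" by blast
    then have \<eta>': "\<bar>\<eta>\<bar> < \<xi>" "0 \<le> \<eta>" "\<eta> < \<xi>" using b b' by auto
    have "0 < m" using elim assms(2) by (simp add: m_def)
    have "tvar \<eta> = trel \<eta> * m\<^sup>2" using \<eta>(3) \<open>0 < m\<close> by (simp add: trel_def)
    also have "\<dots> \<le> \<epsilon> * m\<^sup>2" using a(2)[of \<eta>] \<eta> \<eta>' b by (intro mult_right_mono) auto
    also have "\<dots> = d\<^sup>2 / 2"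
      using assms(2) by (simp add: \<epsilon>_def m_def d_def power_mult_distrib power_divide)
    finally have var: "tvar \<eta> \<le> d\<^sup>2 / 2" .
    \<comment> \<open>Chebyshev's inequality as a minorant: the factor
      \<open>1 - (T \<omega> - m)\<^sup>2 / d\<^sup>2\<close> is at most 1 on the window and
      nonpositive off it.\<close>
    define f where "f \<omega> = T \<omega> ^ 0 * exp (\<eta> * T \<omega>) - (1 / d\<^sup>2) * ((T \<omega> - m)\<^sup>2 * exp (\<eta> * T \<omega>))" for \<omega>
    have int2: "integrable M (\<lambda>\<omega>. (T \<omega> - m)\<^sup>2 * exp (\<eta> * T \<omega>))"
    proof -
      have "integrable M (\<lambda>\<omega>. T \<omega> ^ 2 * exp (\<eta> * T \<omega>) - (2 * m) * (T \<omega> ^ 1 * exp (\<eta> * T \<omega>)) + m\<^sup>2 * (T \<omega> ^ 0 * exp (\<eta> * T \<omega>)))"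
        by (rule Bochner_Integration.integrable_add Bochner_Integration.integrable_diff moment_integrable integrable_mult_right impI \<eta>')+
      then show ?thesis by (simp add: algebra_simps power2_eq_square)
    qed
    have fint: "integrable M f" unfolding f_def
      by (rule Bochner_Integration.integrable_diff moment_integrable integrable_mult_right int2 impI \<eta>')+
    have "expectation f = mom 0 \<eta> - (1 / d\<^sup>2) * (tvar \<eta> * mom 0 \<eta>)"
      unfolding f_def using int2 moment_integrable[OF \<eta>'(1), of 0] tvar_eq[OF \<eta>'(1)]
      by (simp add: mom_def \<eta>(3))
    also have "\<dots> = mom 0 \<eta> * (1 - tvar \<eta> / d\<^sup>2)" by (simp add: algebra_simps)
    also have "\<dots> \<ge> 1 * (1 / 2)"
      using var d mom_ge_1[OF \<eta>'(2,3)] by (intro mult_mono) (auto simp: field_simps)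
    finally have half: "1 / 2 \<le> expectation f" by simp
    show ?case
    proof (rule prob_window_ge[OF \<eta>'(2,3) _ _ fint half])
      fix \<omega>
      have eq: "f \<omega> = (1 - (T \<omega> - m)\<^sup>2 / d\<^sup>2) * exp (\<eta> * T \<omega>)" by (simp add: f_def algebra_simps)
      show "f \<omega> \<le> (if u < T \<omega> \<and> T \<omega> < \<rho> * u then exp (\<eta> * T \<omega>) else 0)"
      proof (cases "u < T \<omega> \<and> T \<omega> < \<rho> * u")
        case True
        then show ?thesis unfolding eq by (simp add: mult_le_cancel_right)
      next
        case False
        have "m - d = u" "m + d = \<rho> * u" by (simp_all add: m_def d_def field_simps)
        with False have "d \<le> \<bar>T \<omega> - m\<bar>" by linarith
        then have "d\<^sup>2 \<le> (T \<omega> - m)\<^sup>2" using d by (simp add: abs_le_square_iff[symmetric])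
        then have "1 - (T \<omega> - m)\<^sup>2 / d\<^sup>2 \<le> 0" using d by (simp add: field_simps)
        then show ?thesis unfolding eq if_not_P[OF False] by (simp add: mult_nonpos_nonneg)
      qed
    qed (use elim assms(2) in auto)
  qed
qed

text \<open>Integrating \<open>(1 / tmean)' = - trel\<close> up to \<open>\<xi>\<close>, where \<open>1 / tmean\<close> vanishes by steepness.\<close>

lemma inverse_tmean_bounds:
  assumes "\<xi>\<^sub>0 \<le> \<eta>" "\<eta> < \<xi>" "0 < tmean \<eta>"
  shows "trel_limit * (\<xi> - \<eta>) \<le> 1 / tmean \<eta>" "1 / tmean \<eta> \<le> trel \<eta> * (\<xi> - \<eta>)"
proof -
  have pos: "0 < tmean x" if "\<eta> \<le> x" "x < \<xi>" for x
    using tmean_mono[of \<eta> x] assms that \<xi>\<^sub>0 by auto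
  have mvt: "\<exists>z. \<eta> < z \<and> z < x \<and> 1 / tmean x - 1 / tmean \<eta> = (x - \<eta>) * (- trel z)" if "\<eta> < x" "x < \<xi>" for x
  proof (rule MVT2[OF that(1)])
    fix y assume "\<eta> \<le> y" "y \<le> x"
    then show "((\<lambda>x. 1 / tmean x) has_real_derivative - trel y) (at y)"
      using pos[of y] tmean_has_derivative[of y] that assms \<xi>\<^sub>0
      by (auto intro!: derivative_eq_intros simp: trel_def power2_eq_square)
  qed
  show "trel_limit * (\<xi> - \<eta>) \<le> 1 / tmean \<eta>"
  proof (rule tendsto_upperbound)
    show "((\<lambda>x. trel_limit * (x - \<eta>)) \<longlongrightarrow> trel_limit * (\<xi> - \<eta>)) (at_left \<xi>)"
      by (intro tendsto_intros)
    show "\<forall>\<^sub>F x in at_left \<xi>. trel_limit * (x - \<eta>) \<le> 1 / tmean \<eta>"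
      using eventually_at_left_real[OF assms(2)]
    proof eventually_elim
      case (elim x)
      then obtain z where z: "\<eta> < z" "z < x" "1 / tmean x - 1 / tmean \<eta> = (x - \<eta>) * (- trel z)"
        using mvt by auto
      have "trel_limit * (x - \<eta>) \<le> trel z * (x - \<eta>)"
        using z elim assms by (intro mult_right_mono trel_limit_le) auto
      also have "\<dots> = 1 / tmean \<eta> - 1 / tmean x" using z(3) by (simp add: algebra_simps)
      also have "\<dots> \<le> 1 / tmean \<eta>" using pos[of x] elim by simp
      finally show ?case .
    qed
  qed simp
  show "1 / tmean \<eta> \<le> trel \<eta> * (\<xi> - \<eta>)"
  proof (rule field_le_epsilon)
    fix e :: real assume e: "0 < e"
    \<comment> \<open>A single point with \<open>1 / e < tmean x\<close> makes the boundary term at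
      most \<open>e\<close>, in place of a passage to the limit.\<close>
    obtain x where x: "\<eta> < x" "x < \<xi>" "1 / e < tmean x" using tmean_unbounded[OF assms(2)] by blast
    then obtain z where z: "\<eta> < z" "z < x" "1 / tmean x - 1 / tmean \<eta> = (x - \<eta>) * (- trel z)"
      using mvt by auto
    have "0 < tmean x" using x pos by simp
    then have ex: "1 / tmean x \<le> e" using x(3) e by (simp add: field_simps)
    have "trel z \<le> trel \<eta>" using z x assms by (intro monotone_onD[OF trel_antimono]) auto
    then have "trel z * (x - \<eta>) \<le> trel \<eta> * (\<xi> - \<eta>)"
      using x trel_nonneg[of \<eta>] assms \<xi>\<^sub>0 by (intro mult_mono) auto
    moreover have "1 / tmean \<eta> = 1 / tmean x + trel z * (x - \<eta>)"
      using z(3) by (simp add: algebra_simps)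
    ultimately show "1 / tmean \<eta> \<le> trel \<eta> * (\<xi> - \<eta>) + e" using ex by simp
  qed
qed

section \<open>Regular variation of the moment generating function at the endpoint\<close>

text \<open>For \<open>x\<close> between \<open>s\<close> and \<open>c * s\<close>,
  \<open>inverse_tmean_bounds\<close> traps \<open>tmean (\<xi> - x)\<close> between
  \<open>1 / (w * x)\<close> and \<open>1 / (v * x)\<close>, where \<open>v\<close> is the limit and
  \<open>w\<close>, the value at \<open>\<xi> - c * s\<close>, is the largest relative variance on
  the range. So \<open>ln (mom 0 (\<xi> - x)) + a * ln x\<close> increases for
  \<open>a = 1 / v\<close> and decreases for \<open>a = 1 / w\<close>; compare its
  endpoints.\<close>

lemma mom_ratio_bounds:
  assumes v: "0 < trel_limit" and s: "0 < s" "1 \<le> c" "c * s \<le> \<xi> - \<xi>\<^sub>0" "0 < tmean (\<xi> - c * s)"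
  shows "c powr - (1 / trel_limit) \<le> mom 0 (\<xi> - c * s) / mom 0 (\<xi> - s)"
    and "mom 0 (\<xi> - c * s) / mom 0 (\<xi> - s) \<le> c powr - (1 / trel (\<xi> - c * s))"
proof -
  let ?v = "trel_limit" and ?w = "trel (\<xi> - c * s)"
  have cs: "s \<le> c * s" "0 < c * s" using s mult_right_mono[of 1 c s] by auto
  have lo: "\<xi>\<^sub>0 \<le> \<xi> - c * s" using s by simp
  have w: "0 < ?w" using trel_limit_le[OF lo] v cs by simp
  have dom: "\<bar>\<xi> - x\<bar> < \<xi>" "0 < tmean (\<xi> - x)" "\<xi>\<^sub>0 \<le> \<xi> - x" "0 < x" if "s \<le> x" "x \<le> c * s" for x
  proof -
    show 1: "\<bar>\<xi> - x\<bar> < \<xi>" "\<xi>\<^sub>0 \<le> \<xi> - x" "0 < x" using that s \<xi>\<^sub>0 by auto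
    show "0 < tmean (\<xi> - x)"
      using tmean_mono[of "\<xi> - c * s" "\<xi> - x"] 1 that s(4) lo cs \<xi>\<^sub>0 by auto
  qed
  have der: "((\<lambda>x. ln (mom 0 (\<xi> - x)) + a * ln x) has_real_derivative a / x - tmean (\<xi> - x)) (at x)"
    if "s \<le> x" "x \<le> c * s" for x a
  proof -
    have "((\<lambda>x. ln (mom 0 (\<xi> - x))) has_real_derivative tmean (\<xi> - x) * - 1) (at x)"
      using dom[OF that] by (intro DERIV_chain2[OF ln_mom_has_derivative]) (auto intro!: derivative_eq_intros)
    moreover have "((\<lambda>x. a * ln x) has_real_derivative a / x) (at x)"
      using dom[OF that] by (auto intro!: derivative_eq_intros)
    ultimately show ?thesis by (auto dest: DERIV_add)
  qed
  have up: "tmean (\<xi> - x) \<le> (1 / ?v) / x" if "s \<le> x" "x \<le> c * s" for x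
  proof -
    have "?v * x \<le> 1 / tmean (\<xi> - x)"
      using inverse_tmean_bounds(1)[of "\<xi> - x"] dom[OF that] by simp
    then show ?thesis using v dom[OF that] by (simp add: field_simps)
  qed
  have down: "(1 / ?w) / x \<le> tmean (\<xi> - x)" if "s \<le> x" "x \<le> c * s" for x
  proof -
    have "1 / tmean (\<xi> - x) \<le> trel (\<xi> - x) * x"
      using inverse_tmean_bounds(2)[of "\<xi> - x"] dom[OF that] by simp
    also have "\<dots> \<le> ?w * x"
      using dom[OF that] that cs s
      by (intro mult_right_mono monotone_onD[OF trel_antimono]) auto
    finally show ?thesis using w dom[OF that] by (simp add: field_simps)
  qed
  have "ln (mom 0 (\<xi> - s)) + 1 / ?v * ln s \<le> ln (mom 0 (\<xi> - c * s)) + 1 / ?v * ln (c * s)"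
  proof (rule DERIV_nonneg_imp_nondecreasing[OF cs(1)])
    fix x assume x: "s \<le> x" "x \<le> c * s"
    show "\<exists>y. ((\<lambda>x. ln (mom 0 (\<xi> - x)) + 1 / ?v * ln x) has_real_derivative y) (at x) \<and> 0 \<le> y"
      using der[OF x, of "1 / ?v"] up[OF x] by (intro exI[of _ "1 / ?v / x - tmean (\<xi> - x)"]) simp
  qed
  moreover have "ln (mom 0 (\<xi> - s)) + 1 / ?w * ln s \<ge> ln (mom 0 (\<xi> - c * s)) + 1 / ?w * ln (c * s)"
  proof (rule DERIV_nonpos_imp_nonincreasing[OF cs(1)])
    fix x assume x: "s \<le> x" "x \<le> c * s"
    show "\<exists>y. ((\<lambda>x. ln (mom 0 (\<xi> - x)) + 1 / ?w * ln x) has_real_derivative y) (at x) \<and> y \<le> 0"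
      using der[OF x, of "1 / ?w"] down[OF x] by (intro exI[of _ "1 / ?w / x - tmean (\<xi> - x)"]) simp
  qed
  moreover have "ln (c * s) = ln c + ln s" using s by (simp add: ln_mult)
  ultimately have L: "- (1 / ?v) * ln c \<le> ln (mom 0 (\<xi> - c * s)) - ln (mom 0 (\<xi> - s))"
    "ln (mom 0 (\<xi> - c * s)) - ln (mom 0 (\<xi> - s)) \<le> - (1 / ?w) * ln c"
    by (simp_all add: algebra_simps add_divide_distrib)
  have m: "0 < mom 0 (\<xi> - c * s)" "0 < mom 0 (\<xi> - s)" using mom_pos dom[of s] dom[of "c * s"] cs by auto
  then have "mom 0 (\<xi> - c * s) / mom 0 (\<xi> - s) = exp (ln (mom 0 (\<xi> - c * s)) - ln (mom 0 (\<xi> - s)))"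
    by (simp add: exp_diff)
  with L s show "c powr - (1 / ?v) \<le> mom 0 (\<xi> - c * s) / mom 0 (\<xi> - s)"
    "mom 0 (\<xi> - c * s) / mom 0 (\<xi> - s) \<le> c powr - (1 / ?w)"
    by (simp_all add: powr_def)
qed

lemma tmean_eventually_pos: "\<forall>\<^sub>F \<eta> in at_left \<xi>. 0 < tmean \<eta>"
proof -
  obtain a where a: "0 < a" "a < \<xi>" "0 < tmean a" using tmean_unbounded[of 0 0] \<xi>_pos by auto
  show ?thesis using eventually_at_left_real[OF a(2)]
  proof eventually_elim
    case (elim x) then show ?case using tmean_mono[of a x] a by auto
  qed
qed

lemma filterlim_left_of_\<xi>: "0 < c \<Longrightarrow> filterlim (\<lambda>u. \<xi> - c / u) (at_left \<xi>) at_top"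
proof (rule tendsto_imp_filterlim_at_left)
  have "((\<lambda>u. c / u) \<longlongrightarrow> 0) at_top"
    by (intro real_tendsto_divide_at_top[OF tendsto_const] filterlim_ident)
  then show "((\<lambda>u. \<xi> - c / u) \<longlongrightarrow> \<xi>) at_top"
    using tendsto_diff[OF tendsto_const[of \<xi>]] by fastforce
  assume "0 < c"
  then show "\<forall>\<^sub>F u in at_top. \<xi> - c / u < \<xi>"
    by (intro eventually_mono[OF eventually_gt_at_top[of 0]]) simp
qed

text \<open>With \<open>s = 1 / u\<close> the two exponents of \<open>mom_ratio_bounds\<close> merge
  in the limit, because the relative variance at \<open>\<xi> - c / u\<close> tends to
  \<open>trel_limit\<close>.\<close>

lemma mom_ratio_tendsto:
  assumes v: "0 < trel_limit" and c: "1 \<le> c"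
  shows "((\<lambda>u. mom 0 (\<xi> - c / u) / mom 0 (\<xi> - 1 / u)) \<longlongrightarrow> c powr - (1 / trel_limit)) at_top"
proof (rule tendsto_sandwich)
  have lim: "filterlim (\<lambda>u. \<xi> - c / u) (at_left \<xi>) at_top"
    using c by (intro filterlim_left_of_\<xi>) simp
  have ev: "\<forall>\<^sub>F u in at_top. 0 < tmean (\<xi> - c / u) \<and> \<xi>\<^sub>0 < \<xi> - c / u"
    using filterlim_iff[THEN iffD1, OF lim, rule_format, OF tmean_eventually_pos]
      filterlim_iff[THEN iffD1, OF lim, rule_format, OF eventually_at_left_real[OF \<xi>\<^sub>0(2)]]
    by eventually_elim auto
  show "\<forall>\<^sub>F u in at_top. c powr - (1 / trel_limit) \<le> mom 0 (\<xi> - c / u) / mom 0 (\<xi> - 1 / u)"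
    using ev eventually_gt_at_top[of 0]
    by eventually_elim (use mom_ratio_bounds(1)[OF v _ c, of "1 / u" for u] in auto)
  show "\<forall>\<^sub>F u in at_top. mom 0 (\<xi> - c / u) / mom 0 (\<xi> - 1 / u) \<le> c powr - (1 / trel (\<xi> - c / u))"
    using ev eventually_gt_at_top[of 0]
    by eventually_elim (use mom_ratio_bounds(2)[OF v _ c, of "1 / u" for u] in auto)
  have "((\<lambda>u. trel (\<xi> - c / u)) \<longlongrightarrow> trel_limit) at_top"
    by (rule filterlim_compose[OF trel_tendsto lim])
  then show "((\<lambda>u. c powr - (1 / trel (\<xi> - c / u))) \<longlongrightarrow> c powr - (1 / trel_limit)) at_top"
    using v c by (intro tendsto_intros) auto
qed simp

text \<open>Taking \<open>s = 1 / u\<close> and \<open>c = r * u\<close> in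
  \<open>mom_ratio_bounds\<close> fixes the far end at \<open>a\<close>, so the moment grows at
  least like a positive power of \<open>u\<close>.\<close>

lemma mom_at_top:
  assumes v: "0 < trel_limit"
  shows "filterlim (\<lambda>u. mom 0 (\<xi> - 1 / u)) at_top at_top"
proof -
  obtain a where a: "\<xi>\<^sub>0 < a" "a < \<xi>" "0 < tmean a" using tmean_unbounded[OF \<xi>\<^sub>0(2)] by blast
  define r where "r = \<xi> - a"
  have r: "0 < r" using a by (simp add: r_def)
  have w: "0 < trel a" using trel_limit_le[of a] a v by simp
  define q where "q = 1 / trel a"
  have q: "0 < q" using w by (simp add: q_def)
  have "filterlim (\<lambda>u. (r * u) powr q) at_top at_top"
    using q r by real_asymp
  then show ?thesis
  proof (rule filterlim_at_top_mono)
    show "\<forall>\<^sub>F u in at_top. (r * u) powr q \<le> mom 0 (\<xi> - 1 / u)"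
      using eventually_gt_at_top[of "1 / r"] eventually_gt_at_top[of 0] eventually_gt_at_top[of "1 / \<xi>"]
    proof eventually_elim
      case (elim u)
      have ru: "1 \<le> r * u" using elim r by (simp add: field_simps)
      have "0 \<le> \<xi> - 1 / u" "\<xi> - 1 / u < \<xi>" using elim \<xi>_pos by (simp_all add: field_simps)
      then have pos: "0 < mom 0 (\<xi> - 1 / u)" by (intro mom_pos) auto
      have eq: "r * u * (1 / u) = r" "\<xi> - r = a" using elim by (simp_all add: r_def)
      have "1 / mom 0 (\<xi> - 1 / u) \<le> mom 0 a / mom 0 (\<xi> - 1 / u)"
        using mom_ge_1[of a] a \<xi>\<^sub>0 pos by (intro divide_right_mono) auto
      also have "\<dots> \<le> (r * u) powr - q"
        unfolding q_def using mom_ratio_bounds(2)[OF v, of "1 / u" "r * u"] ru elim a unfolding eq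
        by (simp add: r_def)
      finally have "1 / mom 0 (\<xi> - 1 / u) \<le> 1 / (r * u) powr q"
        by (simp add: powr_minus divide_inverse)
      then show ?case
        using pos elim r by (simp add: field_simps)
    qed
  qed
qed

text \<open>The factor \<open>exp (- (T \<omega> / u)) ^ j\<close> merely moves the tilt from
  \<open>\<xi> - 1 / u\<close> to \<open>\<xi> - (1 + j) / u\<close>. Discarding
  \<open>T \<omega> < 0\<close>, where the test polynomial is not controlled, costs at most 1, which
  is negligible against the diverging denominator.\<close>

lemma nonneg_part_ratio_tendsto:
  assumes v: "0 < trel_limit"
  shows "((\<lambda>u. expectation (\<lambda>\<omega>. if 0 \<le> T \<omega> then exp (- (T \<omega> / u)) ^ j * exp ((\<xi> - 1 / u) * T \<omega>) else 0)
      / mom 0 (\<xi> - 1 / u)) \<longlongrightarrow> (1 + real j) powr - (1 / trel_limit)) at_top"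
    (is "((\<lambda>u. ?E u / _) \<longlongrightarrow> _) _")
proof -
  let ?c = "1 + real j"
  let ?up = "\<lambda>u. mom 0 (\<xi> - ?c / u) / mom 0 (\<xi> - 1 / u)"
  let ?low = "\<lambda>u. ?up u - 1 / mom 0 (\<xi> - 1 / u)"
  have lim: "(?up \<longlongrightarrow> ?c powr - (1 / trel_limit)) at_top"
    using v by (intro mom_ratio_tendsto) auto
  have "((\<lambda>u. 1 / mom 0 (\<xi> - 1 / u)) \<longlongrightarrow> 0) at_top"
    by (intro real_tendsto_divide_at_top[OF tendsto_const] mom_at_top v)
  from tendsto_diff[OF lim this] have low: "(?low \<longlongrightarrow> ?c powr - (1 / trel_limit)) at_top" by simp
  have key: "\<forall>\<^sub>F u in at_top. 0 < mom 0 (\<xi> - 1 / u) \<and> ?E u \<le> mom 0 (\<xi> - ?c / u) \<and> mom 0 (\<xi> - ?c / u) - 1 \<le> ?E u"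
    using eventually_gt_at_top[of 0] eventually_gt_at_top[of "?c / \<xi>"]
  proof eventually_elim
    case (elim u)
    define \<eta> where "\<eta> = \<xi> - ?c / u"
    have cu: "?c / u < \<xi>" "1 / u \<le> ?c / u" "0 < 1 / u"
      using elim \<xi>_pos by (auto simp: field_simps)
    have "0 < ?c / u" using elim by (intro divide_pos_pos) auto
    then have \<eta>: "\<bar>\<eta>\<bar> < \<xi>" "0 \<le> \<eta>" using cu by (auto simp: \<eta>_def)
    have m: "0 < mom 0 (\<xi> - 1 / u)" using cu by (intro mom_pos) auto
    have E: "?E u = expectation (\<lambda>\<omega>. if 0 \<le> T \<omega> then exp (\<eta> * T \<omega>) else 0)"
    proof (intro Bochner_Integration.integral_cong refl)
      fix \<omega>
      have "exp (- (T \<omega> / u)) ^ j * exp ((\<xi> - 1 / u) * T \<omega>) = exp (\<eta> * T \<omega>)"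
        unfolding exp_of_nat_mult[symmetric] exp_add[symmetric]
        by (rule arg_cong[where f = exp]) (simp add: \<eta>_def algebra_simps add_divide_distrib)
      then show "(if 0 \<le> T \<omega> then exp (- (T \<omega> / u)) ^ j * exp ((\<xi> - 1 / u) * T \<omega>) else 0)
          = (if 0 \<le> T \<omega> then exp (\<eta> * T \<omega>) else 0)" by simp
    qed
    have int: "integrable M (\<lambda>\<omega>. exp (\<eta> * T \<omega>))" by (rule exp_integrable[OF \<eta>(1)])
    have int': "integrable M (\<lambda>\<omega>. if 0 \<le> T \<omega> then exp (\<eta> * T \<omega>) else 0)"
      by (rule Bochner_Integration.integrable_bound[OF int]) auto
    have mom: "mom 0 (\<xi> - ?c / u) = expectation (\<lambda>\<omega>. exp (\<eta> * T \<omega>))" by (simp add: mom_def \<eta>_def)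
    have "?E u \<le> mom 0 (\<xi> - ?c / u)"
      unfolding E mom using int int' by (intro integral_mono) auto
    moreover have "mom 0 (\<xi> - ?c / u) - 1 \<le> ?E u"
    proof -
      have "expectation (\<lambda>\<omega>. exp (\<eta> * T \<omega>) - 1) \<le> ?E u"
        unfolding E using int int' \<eta>(2)
        by (intro integral_mono) (auto simp: mult_nonneg_nonpos)
      then show ?thesis unfolding mom using int by (simp add: prob_space)
    qed
    ultimately show ?case using m by simp
  qed
  have "\<forall>\<^sub>F u in at_top. ?E u / mom 0 (\<xi> - 1 / u) \<le> ?up u"
    using key by eventually_elim (simp add: divide_right_mono)
  moreover have "\<forall>\<^sub>F u in at_top. ?low u \<le> ?E u / mom 0 (\<xi> - 1 / u)"
    using key by eventually_elim (simp add: divide_right_mono flip: diff_divide_distrib)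
  ultimately show ?thesis
    by (intro tendsto_sandwich[OF _ _ low lim])
qed

text \<open>At the tilt \<open>\<xi> - 1 / u\<close> the nonnegative part of \<open>T / u\<close> converges in law to a Gamma
  distribution; testing against a polynomial in \<open>exp (- T / u)\<close> needs only Laplace transforms.\<close>

lemma window_spread:
  assumes v: "0 < trel_limit" and \<rho>: "1 < \<rho>"
  shows "\<exists>c>0. \<forall>\<^sub>F u in at_top. c * exp (- (\<xi> * \<rho> * u)) \<le> prob {\<omega> \<in> space M. u < T \<omega> \<and> T \<omega> < \<rho> * u}"
proof -
  define p where "p = 1 / trel_limit"
  have "0 < p" using v by (simp add: p_def)
  from exp_poly_bump[OF this \<rho>] obtain P :: "real poly" and \<kappa> where P: "0 < \<kappa>"
    "\<And>t. 0 \<le> t \<Longrightarrow> poly P (exp (- t)) \<le> indicator {1<..<\<rho>} t"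
    "\<kappa> \<le> (\<Sum>j\<le>degree P. coeff P j * (1 + real j) powr - p)" by blast
  define g where "g u j \<omega> = (if 0 \<le> T \<omega> then exp (- (T \<omega> / u)) ^ j * exp ((\<xi> - 1 / u) * T \<omega>) else 0)" for u j \<omega>
  have "((\<lambda>u. \<Sum>j\<le>degree P. coeff P j * (expectation (g u j) / mom 0 (\<xi> - 1 / u)))
      \<longlongrightarrow> (\<Sum>j\<le>degree P. coeff P j * (1 + real j) powr - p)) at_top"
    unfolding g_def p_def by (intro tendsto_intros nonneg_part_ratio_tendsto v)
  moreover have "\<kappa> / 2 < (\<Sum>j\<le>degree P. coeff P j * (1 + real j) powr - p)" using P by simp
  ultimately have ev: "\<forall>\<^sub>F u in at_top. \<kappa> / 2 < (\<Sum>j\<le>degree P. coeff P j * (expectation (g u j) / mom 0 (\<xi> - 1 / u)))"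
    by (rule order_tendstoD)
  have "\<forall>\<^sub>F u in at_top. \<kappa> / 2 * exp (- (\<xi> * \<rho> * u)) \<le> prob {\<omega> \<in> space M. u < T \<omega> \<and> T \<omega> < \<rho> * u}"
    using ev eventually_gt_at_top[of 0] eventually_gt_at_top[of "1 / \<xi>"]
  proof eventually_elim
    case (elim u)
    define \<eta> where "\<eta> = \<xi> - 1 / u"
    have "1 / u < \<xi>" "0 < 1 / u" using elim \<xi>_pos by (simp_all add: field_simps)
    then have \<eta>: "0 \<le> \<eta>" "\<eta> < \<xi>" by (simp_all add: \<eta>_def)
    have gint: "integrable M (g u j)" for j
    proof (rule Bochner_Integration.integrable_bound)
      show "integrable M (\<lambda>\<omega>. exp (\<eta> * T \<omega>))" using \<eta> by (intro exp_integrable) auto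
      show "AE \<omega> in M. norm (g u j \<omega>) \<le> norm (exp (\<eta> * T \<omega>))"
        using elim by (auto simp: g_def \<eta>_def intro!: mult_left_le_one_le power_le_one)
    qed (simp add: g_def[abs_def])
    \<comment> \<open>This is \<open>poly P (exp (- (T \<omega> / u))) * exp (\<eta> * T
      \<omega>)\<close> where \<open>T\<close> is nonnegative, and 0 elsewhere.\<close>
    define f where "f \<omega> = (\<Sum>j\<le>degree P. coeff P j * g u j \<omega>)" for \<omega>
    have f: "integrable M f" unfolding f_def using gint by (intro Bochner_Integration.integrable_sum integrable_mult_right)
    have "expectation f = (\<Sum>j\<le>degree P. coeff P j * expectation (g u j))"
      unfolding f_def using gint by (simp add: Bochner_Integration.integral_sum)
    also have "\<dots> = (\<Sum>j\<le>degree P. coeff P j * (expectation (g u j) / mom 0 \<eta>)) * mom 0 \<eta>"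
      using mom_pos[of \<eta>] \<eta> by (simp add: sum_distrib_right)
    also have "\<dots> \<ge> (\<kappa> / 2) * 1"
      using elim(1) mom_ge_1[OF \<eta>] P(1) unfolding \<eta>_def[symmetric] by (intro mult_mono) auto
    finally have E: "\<kappa> / 2 \<le> expectation f" by simp
    show ?case
    proof (rule prob_window_ge[OF \<eta> _ _ f E])
      fix \<omega>
      show "f \<omega> \<le> (if u < T \<omega> \<and> T \<omega> < \<rho> * u then exp (\<eta> * T \<omega>) else 0)"
      proof (cases "0 \<le> T \<omega>")
        case True
        then have "f \<omega> = poly P (exp (- (T \<omega> / u))) * exp (\<eta> * T \<omega>)"
          by (simp add: f_def g_def \<eta>_def poly_altdef sum_distrib_right mult.assoc)
        also have "\<dots> \<le> indicator {1<..<\<rho>} (T \<omega> / u) * exp (\<eta> * T \<omega>)"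
          using True elim by (intro mult_right_mono P(2)) auto
        finally show ?thesis using elim by (auto simp: indicator_def field_simps split: if_splits)
      next
        case False
        then show ?thesis by (simp add: f_def g_def)
      qed
    qed (use elim \<rho> in auto)
  qed
  then show ?thesis using P(1) by (intro exI[of _ "\<kappa> / 2"]) simp
qed

lemma window_lower_bound:
  assumes "1 < \<rho>"
  shows "\<exists>c>0. \<forall>\<^sub>F u in at_top. c * exp (- (\<xi> * \<rho> * u)) \<le> prob {\<omega> \<in> space M. u < T \<omega> \<and> T \<omega> < \<rho> * u}"
proof (cases "trel_limit = 0")
  case True
  then show ?thesis
    using window_concentrated[OF True assms] by (intro exI[of _ "1 / 2"]) simp
next
  case False
  then show ?thesis using window_spread[OF _ assms] trel_limit_nonneg by simp
qed

end

section \<open>Sums of independent copies\<close>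

lemma ext_log_ennreal: "ext_log (ennreal p) = (if p \<le> 0 then -\<infinity> else ereal (ln p))"
  by (auto simp: ext_log_def ennreal_eq_0_iff)

lemma scaled_ext_log_le:
  assumes "p \<le> exp (- (v * c))" "0 < v"
  shows "ereal (1 / v) * ext_log (ennreal p) \<le> ereal (- c)"
proof (cases "p \<le> 0")
  case False
  then have "ln p \<le> ln (exp (- (v * c)))" using assms by (subst ln_le_cancel_iff) auto
  then show ?thesis using assms False by (simp add: ext_log_ennreal field_simps)
qed (use assms in \<open>simp add: ext_log_ennreal\<close>)

lemma scaled_ext_log_ge:
  assumes "exp (- (v * c)) \<le> p" "0 < v"
  shows "ereal (- c) \<le> ereal (1 / v) * ext_log (ennreal p)"
proof -
  have p: "0 < p" using assms(1) exp_gt_zero[of "- (v * c)"] by linarith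
  then have "- (v * c) \<le> ln p" using assms(1) by (simp add: ln_ge_iff)
  then show ?thesis using assms p by (simp add: ext_log_ennreal field_simps)
qed

text \<open>On \<open>{0..<t}\<close> one has \<open>s * x \<le> \<eta> * phi \<alpha> x\<close>,
  since \<open>x powr (\<alpha> - 1)\<close> decreases in \<open>x\<close>; the exponential weight
  on the right then controls the Taylor remainder. The summand 1 next to the weight serves negative
  \<open>x\<close>, and for \<open>x \<ge> t\<close> the left side vanishes.\<close>

lemma exp_truncated_le:
  assumes \<alpha>: "0 < \<alpha>" "\<alpha> < 1" and \<eta>: "0 \<le> \<eta>" and t: "0 < t"
  defines "s \<equiv> \<eta> * t powr (\<alpha> - 1)"
  shows "(if x < t then exp (s * x) else 0) \<le> 1 + s * x + 3 * s\<^sup>2 * (x\<^sup>2 * (1 + exp (\<eta> * phi \<alpha> x)))"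
proof -
  have s: "0 \<le> s" using \<eta> by (simp add: s_def)
  consider "t \<le> x" | "x < 0" | "0 \<le> x" "x < t" by linarith
  then show ?thesis
  proof cases
    case 1
    then show ?thesis using s t by (simp add: add_nonneg_nonneg)
  next
    case 2
    then have "exp (s * x) \<le> 1 + s * x + 3 * (s * x)\<^sup>2"
      using s by (intro exp_le_quadratic_nonpos) (simp add: mult_nonneg_nonpos)
    also have "\<dots> \<le> 1 + s * x + 3 * s\<^sup>2 * (x\<^sup>2 * (1 + exp (\<eta> * phi \<alpha> x)))"
      by (simp add: power_mult_distrib distrib_left)
    finally show ?thesis using 2 t by simp
  next
    case 3
    have "t powr (\<alpha> - 1) * x \<le> x powr \<alpha>"
    proof (cases "x = 0")
      case False
      then have "t powr (\<alpha> - 1) \<le> x powr (\<alpha> - 1)" using 3 \<alpha> by (intro powr_mono2') auto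
      then have "t powr (\<alpha> - 1) * x \<le> x powr (\<alpha> - 1) * x" using 3 by (intro mult_right_mono) auto
      also have "\<dots> = x powr \<alpha>" using 3 False by (simp add: powr_diff)
      finally show ?thesis .
    qed simp
    then have sx: "s * x \<le> \<eta> * phi \<alpha> x"
      using \<eta> 3 mult_left_mono[of "t powr (\<alpha> - 1) * x" "x powr \<alpha>" \<eta>]
      by (cases "x = 0") (auto simp: s_def phi_def mult.assoc)
    have "exp (s * x) \<le> 1 + s * x + (s * x)\<^sup>2 * exp (s * x)"
      using exp_Taylor_quadratic[of "s * x"] s 3 by simp
    also have "(s * x)\<^sup>2 * exp (s * x) \<le> (s * x)\<^sup>2 * (3 * (1 + exp (\<eta> * phi \<alpha> x)))"
    proof (intro mult_left_mono)
      have "exp (s * x) \<le> exp (\<eta> * phi \<alpha> x)" using sx by simp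
      then show "exp (s * x) \<le> 3 * (1 + exp (\<eta> * phi \<alpha> x))"
        by (rule order_trans) (simp add: add_increasing)
    qed simp
    finally show ?thesis using 3 by (simp add: power_mult_distrib algebra_simps)
  qed
qed

lemma phi_measurable[measurable]: "phi \<alpha> \<in> borel_measurable borel"
  unfolding phi_def[abs_def] by measurable

lemma abs_phi: "\<bar>phi \<alpha> x\<bar> = \<bar>x\<bar> powr \<alpha>"
  by (cases "x = 0") (auto simp: phi_def abs_mult)

lemma phi_window:
  assumes "0 < \<alpha>" "0 < a" "0 < b" "a powr \<alpha> < phi \<alpha> x" "phi \<alpha> x < b powr \<alpha>"
  shows "a < x" "x < b"
proof -
  have "0 < phi \<alpha> x" using assms(4) powr_ge_zero[of a \<alpha>] by linarith
  then have x: "0 < x" by (auto simp: phi_def sgn_if split: if_splits)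
  then have "phi \<alpha> x = x powr \<alpha>" by (simp add: phi_def)
  with assms x show "a < x" "x < b"
    using powr_mono2[of \<alpha> x a] powr_mono2[of \<alpha> b x] by (force simp: not_less[symmetric])+
qed

section \<open>The independent copies and their symmetry\<close>

locale stretched_sums = steep_moments M "\<lambda>\<omega>. phi \<alpha> (X \<omega>)" \<xi> \<xi>\<^sub>0 + N: prob_space N
  for M :: "'a measure" and X :: "'a \<Rightarrow> real" and \<alpha> \<xi> \<xi>\<^sub>0 :: real and N :: "'b measure" +
  fixes Y :: "nat \<Rightarrow> 'b \<Rightarrow> real"
  assumes X_measurable[measurable]: "X \<in> borel_measurable M"
    and X_symmetric: "distr M borel (\<lambda>\<omega>. - X \<omega>) = distr M borel X"
    and X_integrable: "integrable M X"
    and \<alpha>: "0 < \<alpha>" "\<alpha> < 1"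
    and Y_indep: "N.indep_vars (\<lambda>_. borel) Y {1..}"
    and Y_copies: "\<And>i. 1 \<le> i \<Longrightarrow> distr N borel (Y i) = distr M borel X"
begin

lemma Y_measurable: "1 \<le> i \<Longrightarrow> Y i \<in> borel_measurable N"
  using Y_indep by (auto simp: N.indep_vars_def)

lemma sum_measurable: "1 \<le> k \<Longrightarrow> (\<lambda>\<omega>. \<Sum>i=k..n. Y i \<omega>) \<in> borel_measurable N"
  by (intro borel_measurable_sum Y_measurable) auto

text \<open>By symmetry of \<open>X\<close>, statements about right tails can be reused for left
  tails by reinterpreting the locale.\<close>

lemma stretched_sums_uminus: "stretched_sums M X \<alpha> \<xi> \<xi>\<^sub>0 N (\<lambda>i \<omega>. - Y i \<omega>)"
proof (intro stretched_sums.intro stretched_sums_axioms.intro)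
  show "N.indep_vars (\<lambda>_. borel) (\<lambda>i \<omega>. - Y i \<omega>) {1..}"
    using N.indep_vars_compose2[OF Y_indep, of "\<lambda>_. uminus" "\<lambda>_. borel"] by simp
  fix i :: nat assume i: "1 \<le> i"
  have "distr N borel (\<lambda>\<omega>. - Y i \<omega>) = distr (distr N borel (Y i)) borel uminus"
    using Y_measurable[OF i] by (subst distr_distr) (auto simp: comp_def)
  also have "\<dots> = distr (distr M borel X) borel uminus" by (simp add: Y_copies[OF i])
  also have "\<dots> = distr M borel (\<lambda>\<omega>. - X \<omega>)" by (subst distr_distr) (auto simp: comp_def)
  finally show "distr N borel (\<lambda>\<omega>. - Y i \<omega>) = distr M borel X" by (simp add: X_symmetric)
qed (use X_symmetric X_integrable \<alpha> steep_moments_axioms N.prob_space_axioms in auto)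

lemma expectation_copy:
  fixes g :: "real \<Rightarrow> real"
  assumes "1 \<le> i" "g \<in> borel_measurable borel"
  shows "N.expectation (\<lambda>\<omega>. g (Y i \<omega>)) = expectation (\<lambda>\<omega>. g (X \<omega>))"
  using integral_distr[OF Y_measurable[OF assms(1)] assms(2)] integral_distr[OF X_measurable assms(2)]
  by (simp add: Y_copies[OF assms(1)])

lemma prob_copy:
  assumes "1 \<le> i" "A \<in> sets borel"
  shows "N.prob {\<omega> \<in> space N. Y i \<omega> \<in> A} = prob {\<omega> \<in> space M. X \<omega> \<in> A}"
proof -
  have "measure (distr N borel (Y i)) A = measure (distr M borel X) A" by (simp add: Y_copies[OF assms(1)])
  then show ?thesis
    using Y_measurable[OF assms(1)] assms(2) by (simp add: measure_distr vimage_def Int_def conj_commute)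
qed

lemma expectation_X: "expectation X = 0"
proof -
  have "(\<integral>x. x \<partial>distr M borel (\<lambda>\<omega>. - X \<omega>)) = expectation (\<lambda>\<omega>. - X \<omega>)"
    by (rule integral_distr) auto
  moreover have "(\<integral>x. x \<partial>distr M borel X) = expectation X" by (rule integral_distr) auto
  ultimately show ?thesis by (simp add: X_symmetric)
qed

section \<open>Upper bound by truncation\<close>

text \<open>The coefficient of \<open>s\<^sup>2\<close> in the truncated exponential moment; it does
  not depend on the truncation level.\<close>

definition trunc_const :: "real \<Rightarrow> real" where
  "trunc_const \<eta> = 3 * expectation (\<lambda>\<omega>. (X \<omega>)\<^sup>2 * (1 + exp (\<eta> * phi \<alpha> (X \<omega>))))"

lemma trunc_const_nonneg: "0 \<le> trunc_const \<eta>"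
  by (simp add: trunc_const_def add_nonneg_nonneg)

text \<open>As soon as \<open>\<alpha> * k \<ge> 2\<close>, the square of \<open>X\<close> is at
  most \<open>1 + \<bar>phi \<alpha> (X \<omega>)\<bar> ^ k\<close>, so moments of the transformed
  variable suffice.\<close>

lemma square_exp_integrable:
  assumes "\<bar>\<eta>\<bar> < \<xi>"
  shows "integrable M (\<lambda>\<omega>. (X \<omega>)\<^sup>2 * (1 + exp (\<eta> * phi \<alpha> (X \<omega>))))"
proof -
  obtain k :: nat where k: "2 / \<alpha> \<le> real k" using real_arch_simple by blast
  then have k2: "2 \<le> \<alpha> * real k" using \<alpha> by (simp add: field_simps)
  have int: "integrable M (\<lambda>\<omega>. (X \<omega>)\<^sup>2 * exp (\<eta> * phi \<alpha> (X \<omega>)))" if "\<bar>\<eta>\<bar> < \<xi>" for \<eta>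
  proof (rule Bochner_Integration.integrable_bound)
    show "integrable M (\<lambda>\<omega>. \<bar>phi \<alpha> (X \<omega>)\<bar> ^ 0 * exp (\<eta> * phi \<alpha> (X \<omega>) + 0 * \<bar>phi \<alpha> (X \<omega>)\<bar>)
        + \<bar>phi \<alpha> (X \<omega>)\<bar> ^ k * exp (\<eta> * phi \<alpha> (X \<omega>) + 0 * \<bar>phi \<alpha> (X \<omega>)\<bar>))"
      using that by (intro Bochner_Integration.integrable_add abs_moment_integrable) auto
    show "AE \<omega> in M. norm ((X \<omega>)\<^sup>2 * exp (\<eta> * phi \<alpha> (X \<omega>)))
      \<le> norm (\<bar>phi \<alpha> (X \<omega>)\<bar> ^ 0 * exp (\<eta> * phi \<alpha> (X \<omega>) + 0 * \<bar>phi \<alpha> (X \<omega>)\<bar>)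
        + \<bar>phi \<alpha> (X \<omega>)\<bar> ^ k * exp (\<eta> * phi \<alpha> (X \<omega>) + 0 * \<bar>phi \<alpha> (X \<omega>)\<bar>))"
    proof (rule AE_I2)
      fix \<omega>
      have "(X \<omega>)\<^sup>2 \<le> 1 + \<bar>phi \<alpha> (X \<omega>)\<bar> ^ k"
      proof (cases "\<bar>X \<omega>\<bar> \<le> 1")
        case True
        then have "(X \<omega>)\<^sup>2 \<le> 1" by (simp add: abs_square_le_1)
        then show ?thesis by (simp add: add_increasing2)
      next
        case False
        then have "(X \<omega>)\<^sup>2 = \<bar>X \<omega>\<bar> powr 2" by (simp add: powr_numeral)
        also have "\<dots> \<le> \<bar>X \<omega>\<bar> powr (\<alpha> * real k)" using False k2 by (intro powr_mono) auto
        also have "\<dots> = \<bar>phi \<alpha> (X \<omega>)\<bar> ^ k" using False by (simp add: abs_phi powr_powr[symmetric] powr_realpow)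
        finally show ?thesis by simp
      qed
      then have "(X \<omega>)\<^sup>2 * exp (\<eta> * phi \<alpha> (X \<omega>)) \<le> (1 + \<bar>phi \<alpha> (X \<omega>)\<bar> ^ k) * exp (\<eta> * phi \<alpha> (X \<omega>))"
        by (intro mult_right_mono) auto
      then show "norm ((X \<omega>)\<^sup>2 * exp (\<eta> * phi \<alpha> (X \<omega>)))
        \<le> norm (\<bar>phi \<alpha> (X \<omega>)\<bar> ^ 0 * exp (\<eta> * phi \<alpha> (X \<omega>) + 0 * \<bar>phi \<alpha> (X \<omega>)\<bar>)
        + \<bar>phi \<alpha> (X \<omega>)\<bar> ^ k * exp (\<eta> * phi \<alpha> (X \<omega>) + 0 * \<bar>phi \<alpha> (X \<omega>)\<bar>))"
        by (simp add: algebra_simps)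
    qed
  qed simp
  show ?thesis
    using Bochner_Integration.integrable_add[OF int[of 0] int[OF assms]] \<xi>_pos by (simp add: algebra_simps)
qed

text \<open>The linear term of \<open>exp_truncated_le\<close> has mean 0, which leaves one plus a
  multiple of \<open>s\<^sup>2\<close>.\<close>

lemma expectation_truncated_le:
  assumes "0 \<le> \<eta>" "\<eta> < \<xi>" "0 < t"
  defines "s \<equiv> \<eta> * t powr (\<alpha> - 1)"
  shows "expectation (\<lambda>\<omega>. if X \<omega> < t then exp (s * X \<omega>) else 0) \<le> exp (trunc_const \<eta> * s\<^sup>2)"
proof -
  let ?g = "\<lambda>\<omega>. (X \<omega>)\<^sup>2 * (1 + exp (\<eta> * phi \<alpha> (X \<omega>)))"
  have g: "integrable M ?g" using assms by (intro square_exp_integrable) auto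
  have s: "0 \<le> s" using assms by (simp add: s_def)
  have "integrable M (\<lambda>\<omega>. if X \<omega> < t then exp (s * X \<omega>) else 0)"
    by (rule integrable_const_bound[where B = "exp (s * t)"]) (use s in \<open>auto intro!: mult_left_mono\<close>)
  then have "expectation (\<lambda>\<omega>. if X \<omega> < t then exp (s * X \<omega>) else 0)
      \<le> expectation (\<lambda>\<omega>. 1 + s * X \<omega> + (3 * s\<^sup>2) * ?g \<omega>)"
    using exp_truncated_le[OF \<alpha> assms(1,3)] g X_integrable unfolding s_def
    by (intro integral_mono Bochner_Integration.integrable_add integrable_mult_right) auto
  also have "\<dots> = 1 + s * 0 + (3 * s\<^sup>2) * expectation ?g"
    using g X_integrable expectation_X
    by (subst Bochner_Integration.integral_add)
      (auto simp: prob_space intro!: Bochner_Integration.integrable_add integrable_mult_right)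
  also have "\<dots> \<le> exp (trunc_const \<eta> * s\<^sup>2)"
    using exp_ge_add_one_self[of "trunc_const \<eta> * s\<^sup>2"] by (simp add: trunc_const_def algebra_simps)
  finally show ?thesis .
qed

lemma single_tail_le:
  assumes "0 \<le> \<eta>" "\<eta> < \<xi>" "0 < t"
  shows "prob {\<omega> \<in> space M. X \<omega> \<in> {t..}} \<le> exp (- (\<eta> * t powr \<alpha>)) * mom 0 \<eta>"
proof -
  have "exp (\<eta> * t powr \<alpha>) * prob {\<omega> \<in> space M. X \<omega> \<in> {t..}}
      = expectation (\<lambda>\<omega>. exp (\<eta> * t powr \<alpha>) * indicator {\<omega> \<in> space M. X \<omega> \<in> {t..}} \<omega>)"
    by simp
  also have "\<dots> \<le> expectation (\<lambda>\<omega>. exp (\<eta> * phi \<alpha> (X \<omega>)))"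
  proof (rule integral_mono)
    fix \<omega>
    show "exp (\<eta> * t powr \<alpha>) * indicator {\<omega> \<in> space M. X \<omega> \<in> {t..}} \<omega> \<le> exp (\<eta> * phi \<alpha> (X \<omega>))"
      using assms \<alpha> powr_mono2[of \<alpha> t "X \<omega>"] by (auto simp: indicator_def phi_def intro!: mult_left_mono)
  qed (use assms in \<open>auto intro!: exp_integrable integrable_real_mult_indicator simp: less_top[symmetric]\<close>)
  finally show ?thesis by (simp add: mom_def exp_minus field_simps)
qed

text \<open>Either some summand reaches \<open>t\<close>, handled by a union bound, or all stay
  below \<open>t\<close>, handled by the exponential Markov inequality for truncated summands and
  independence. The choice of \<open>s\<close> gives
  \<open>s * t = \<eta> * t powr \<alpha>\<close>, so both cases decay at the same rate.\<close>

lemma sum_tail_le: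
  assumes \<eta>: "0 \<le> \<eta>" "\<eta> < \<xi>" and t: "0 < t" and J: "finite J" "J \<subseteq> {1..}" "J \<noteq> {}"
  defines "s \<equiv> \<eta> * t powr (\<alpha> - 1)"
  shows "N.prob {\<omega> \<in> space N. t \<le> (\<Sum>i\<in>J. Y i \<omega>)}
    \<le> exp (- (\<eta> * t powr \<alpha>)) * (real (card J) * mom 0 \<eta> + exp (real (card J) * (trunc_const \<eta> * s\<^sup>2)))"
proof -
  have [measurable]: "Y i \<in> borel_measurable N" if "i \<in> J" for i using J that by (intro Y_measurable) auto
  define g where "g x = (if x < t then exp (s * x) else 0)" for x
  have g_meas[measurable]: "g \<in> borel_measurable borel" unfolding g_def by measurable
  have g_nonneg: "0 \<le> g x" for x by (simp add: g_def)
  have s: "0 \<le> s" using \<eta> by (simp add: s_def)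
  have st: "s * t = \<eta> * t powr \<alpha>" using t by (simp add: s_def powr_diff)
  let ?A = "\<lambda>i. {\<omega> \<in> space N. Y i \<omega> \<in> {t..}}"
  let ?B = "{\<omega> \<in> space N. (\<forall>i\<in>J. Y i \<omega> < t) \<and> t \<le> (\<Sum>i\<in>J. Y i \<omega>)}"
  have B_meas: "?B \<in> N.events" using J(1) by measurable
  have A_meas: "?A i \<in> N.events" if "i \<in> J" for i using that by measurable
  have "{\<omega> \<in> space N. t \<le> (\<Sum>i\<in>J. Y i \<omega>)} \<subseteq> (\<Union>i\<in>J. ?A i) \<union> ?B" by (auto simp: not_less)
  then have "N.prob {\<omega> \<in> space N. t \<le> (\<Sum>i\<in>J. Y i \<omega>)} \<le> N.prob ((\<Union>i\<in>J. ?A i) \<union> ?B)"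
    using A_meas B_meas J(1) by (intro N.finite_measure_mono) auto
  also have "\<dots> \<le> N.prob (\<Union>i\<in>J. ?A i) + N.prob ?B"
    using A_meas B_meas J(1) by (intro measure_Un_le) auto
  also have "N.prob (\<Union>i\<in>J. ?A i) \<le> (\<Sum>i\<in>J. N.prob (?A i))"
    using A_meas J(1) by (intro N.finite_measure_subadditive_finite) auto
  also have "\<dots> = (\<Sum>i\<in>J. prob {\<omega> \<in> space M. X \<omega> \<in> {t..}})"
    using J(2) by (intro sum.cong refl prob_copy) auto
  also have "\<dots> \<le> real (card J) * (exp (- (\<eta> * t powr \<alpha>)) * mom 0 \<eta>)"
    using single_tail_le[OF \<eta> t] by (simp add: mult_left_mono)
  finally have 1: "N.prob {\<omega> \<in> space N. t \<le> (\<Sum>i\<in>J. Y i \<omega>)}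
      \<le> real (card J) * (exp (- (\<eta> * t powr \<alpha>)) * mom 0 \<eta>) + N.prob ?B" by simp
  have indep: "N.indep_vars (\<lambda>_. borel) (\<lambda>i \<omega>. g (Y i \<omega>)) J"
    using N.indep_vars_compose2[OF N.indep_vars_subset[OF Y_indep J(2)], of "\<lambda>_. g" "\<lambda>_. borel"] by simp
  have gint: "integrable N (\<lambda>\<omega>. g (Y i \<omega>))" if "i \<in> J" for i
  proof (rule N.integrable_const_bound[where B = "exp (s * t)"])
    show "AE \<omega> in N. norm (g (Y i \<omega>)) \<le> exp (s * t)"
      using s by (auto simp: g_def intro!: mult_left_mono)
  qed (use that in measurable)
  note prod = N.indep_vars_lebesgue_integral[OF J(1) indep gint] N.indep_vars_integrable[OF J(1) indep gint]
  have "exp (s * t) * N.prob ?B = N.expectation (\<lambda>\<omega>. exp (s * t) * indicator ?B \<omega>)"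
    using B_meas by simp
  also have "\<dots> \<le> N.expectation (\<lambda>\<omega>. \<Prod>i\<in>J. g (Y i \<omega>))"
  proof (rule integral_mono)
    show "integrable N (\<lambda>\<omega>. exp (s * t) * indicator ?B \<omega>)"
      using B_meas by (auto simp: less_top[symmetric] intro!: integrable_mult_right)
    fix \<omega>
    show "exp (s * t) * indicator ?B \<omega> \<le> (\<Prod>i\<in>J. g (Y i \<omega>))"
    proof (cases "\<omega> \<in> ?B")
      case True
      have "(\<Prod>i\<in>J. g (Y i \<omega>)) = (\<Prod>i\<in>J. exp (s * Y i \<omega>))"
        using True by (intro prod.cong) (auto simp: g_def)
      also have "\<dots> = exp (s * (\<Sum>i\<in>J. Y i \<omega>))"
        using J(1) by (simp add: exp_sum sum_distrib_left)
      also have "\<dots> \<ge> exp (s * t)" using True s by (auto intro!: mult_left_mono)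
      finally show ?thesis using True by simp
    next
      case False
      then show ?thesis by (simp add: prod_nonneg g_nonneg)
    qed
  qed (rule prod(2))
  also have "\<dots> = (\<Prod>i\<in>J. N.expectation (\<lambda>\<omega>. g (Y i \<omega>)))" by (rule prod(1))
  also have "\<dots> \<le> (\<Prod>i\<in>J. exp (trunc_const \<eta> * s\<^sup>2))"
  proof (rule prod_mono)
    fix i assume i: "i \<in> J"
    have "N.expectation (\<lambda>\<omega>. g (Y i \<omega>)) = expectation (\<lambda>\<omega>. g (X \<omega>))"
      using i J(2) by (intro expectation_copy) auto
    also have "\<dots> \<le> exp (trunc_const \<eta> * s\<^sup>2)"
      using expectation_truncated_le[OF \<eta> t] unfolding g_def s_def .
    finally show "0 \<le> N.expectation (\<lambda>\<omega>. g (Y i \<omega>)) \<and> N.expectation (\<lambda>\<omega>. g (Y i \<omega>)) \<le> exp (trunc_const \<eta> * s\<^sup>2)"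
      using g_nonneg by simp
  qed
  also have "\<dots> = exp (real (card J) * (trunc_const \<eta> * s\<^sup>2))" by (simp add: exp_of_nat_mult)
  finally have "N.prob ?B \<le> exp (- (\<eta> * t powr \<alpha>)) * exp (real (card J) * (trunc_const \<eta> * s\<^sup>2))"
    unfolding st by (simp add: exp_minus field_simps)
  with 1 show ?thesis by (simp add: algebra_simps)
qed

text \<open>Half of \<open>e\<close> pays for replacing \<xi> by a smaller \<eta>, the other half
  absorbs the prefactor of \<open>sum_tail_le\<close>. The start index \<open>k\<close> is free
  because the lower bound leaves out the first summand.\<close>

lemma upper_tail:
  assumes x: "0 < x" and e: "0 < e" and k: "1 \<le> k"
  shows "\<forall>\<^sub>F n in sequentially. N.prob {\<omega> \<in> space N. real n * x \<le> (\<Sum>i=k..n. Y i \<omega>)}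
    \<le> exp (- (real n powr \<alpha> * (\<xi> * x powr \<alpha> - e)))"
proof -
  \<comment> \<open>The first term limits the loss in the exponent to \<open>e / 2\<close>; the
    second keeps \<eta> positive.\<close>
  define d where "d = min (e / (2 * x powr \<alpha>)) (\<xi> / 2)"
  define \<eta> where "\<eta> = \<xi> - d"
  have d: "0 < d" "d \<le> \<xi> / 2" "d * x powr \<alpha> \<le> e / 2"
    using e x \<xi>_pos by (auto simp: d_def min_def field_simps)
  have \<eta>: "0 < \<eta>" "\<eta> < \<xi>" using d \<xi>_pos by (auto simp: \<eta>_def)
  have \<eta>x: "\<xi> * x powr \<alpha> - e / 2 \<le> \<eta> * x powr \<alpha>" using d(3) by (simp add: \<eta>_def algebra_simps)
  define m where "m = mom 0 \<eta>"
  define K where "K = trunc_const \<eta> * (\<eta> * x powr (\<alpha> - 1))\<^sup>2 + 1"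
  have m: "0 < m" unfolding m_def using \<eta> by (intro mom_pos) auto
  have K: "0 < K" using trunc_const_nonneg[of \<eta>] by (auto simp: K_def intro!: add_nonneg_pos)
  have "((\<lambda>n. real n * m * exp (- (real n powr \<alpha> * (e / 2)))) \<longlongrightarrow> 0) sequentially"
    using \<alpha> e m by real_asymp
  then have ev1: "\<forall>\<^sub>F n in sequentially. real n * m * exp (- (real n powr \<alpha> * (e / 2))) < 1 / 2"
    by (rule order_tendstoD) simp
  \<comment> \<open>The quantity \<open>n * s\<^sup>2\<close> is of order
    \<open>n powr (2 * \<alpha> - 1)\<close>, which is negligible against the speed because
    \<open>\<alpha> < 1\<close>.\<close>
  have "((\<lambda>n. K * real n powr (2 * \<alpha> - 1) / real n powr \<alpha>) \<longlongrightarrow> 0) sequentially"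
    using \<alpha> K by real_asymp
  then have ev2: "\<forall>\<^sub>F n in sequentially. K * real n powr (2 * \<alpha> - 1) / real n powr \<alpha> < e / 4"
    by (rule order_tendstoD) (use e in simp)
  have "filterlim (\<lambda>n. real n powr \<alpha> * (e / 4)) at_top sequentially"
    using \<alpha> e by real_asymp
  then have ev3: "\<forall>\<^sub>F n in sequentially. ln 2 \<le> real n powr \<alpha> * (e / 4)"
    by (simp add: filterlim_at_top)
  show ?thesis
    using ev1 ev2 ev3 eventually_ge_at_top[of k] eventually_gt_at_top[of 0]
  proof eventually_elim
    case (elim n)
    let ?J = "{k..n}" and ?t = "real n * x"
    have t: "0 < ?t" using elim x by simp
    have n: "0 < real n powr \<alpha>" using elim by simp
    have card: "real (card ?J) \<le> real n" using k by auto
    have K': "K * real n powr (2 * \<alpha> - 1) \<le> real n powr \<alpha> * (e / 4)"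
      using elim(2) n by (simp add: field_simps)
    have s2: "(\<eta> * ?t powr (\<alpha> - 1))\<^sup>2 * real n = (\<eta> * x powr (\<alpha> - 1))\<^sup>2 * real n powr (2 * \<alpha> - 1)"
    proof -
      have "(real n powr (\<alpha> - 1))\<^sup>2 * real n = real n powr (2 * (\<alpha> - 1)) * real n powr 1"
        using elim by (simp add: powr_power mult.commute)
      also have "\<dots> = real n powr (2 * \<alpha> - 1)" unfolding powr_add[symmetric] by (simp add: algebra_simps)
      finally have *: "(real n powr (\<alpha> - 1))\<^sup>2 * real n = real n powr (2 * \<alpha> - 1)" .
      have "(\<eta> * ?t powr (\<alpha> - 1))\<^sup>2 * real n = (\<eta> * x powr (\<alpha> - 1))\<^sup>2 * ((real n powr (\<alpha> - 1))\<^sup>2 * real n)"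
        using x by (simp add: powr_mult power_mult_distrib)
      then show ?thesis unfolding * .
    qed
    have "real (card ?J) * (trunc_const \<eta> * (\<eta> * ?t powr (\<alpha> - 1))\<^sup>2)
        \<le> real n * (trunc_const \<eta> * (\<eta> * ?t powr (\<alpha> - 1))\<^sup>2)"
      using card trunc_const_nonneg by (intro mult_right_mono) auto
    also have "\<dots> = trunc_const \<eta> * ((\<eta> * ?t powr (\<alpha> - 1))\<^sup>2 * real n)" by simp
    also have "\<dots> = trunc_const \<eta> * (\<eta> * x powr (\<alpha> - 1))\<^sup>2 * real n powr (2 * \<alpha> - 1)"
      unfolding s2 by simp
    also have "\<dots> \<le> K * real n powr (2 * \<alpha> - 1)"
      by (intro mult_right_mono) (auto simp: K_def)
    also have "\<dots> \<le> real n powr \<alpha> * (e / 2) - ln 2" using K' elim(3) by simp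
    finally have "exp (real (card ?J) * (trunc_const \<eta> * (\<eta> * ?t powr (\<alpha> - 1))\<^sup>2)) \<le> exp (real n powr \<alpha> * (e / 2) - ln 2)"
      by simp
    also have "\<dots> = exp (real n powr \<alpha> * (e / 2)) / 2" by (simp add: exp_diff)
    finally have b2: "exp (real (card ?J) * (trunc_const \<eta> * (\<eta> * ?t powr (\<alpha> - 1))\<^sup>2)) \<le> exp (real n powr \<alpha> * (e / 2)) / 2" .
    have "real (card ?J) * m \<le> real n * m" using card m by (intro mult_right_mono) auto
    also have "\<dots> \<le> exp (real n powr \<alpha> * (e / 2)) / 2"
      using elim(1) by (simp add: exp_minus field_simps)
    finally have b1: "real (card ?J) * m \<le> exp (real n powr \<alpha> * (e / 2)) / 2" .
    have "N.prob {\<omega> \<in> space N. ?t \<le> (\<Sum>i=k..n. Y i \<omega>)}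
      \<le> exp (- (\<eta> * ?t powr \<alpha>)) * (real (card ?J) * m + exp (real (card ?J) * (trunc_const \<eta> * (\<eta> * ?t powr (\<alpha> - 1))\<^sup>2)))"
      unfolding m_def using \<eta> t elim k by (intro sum_tail_le) auto
    also have "\<dots> \<le> exp (- (\<eta> * ?t powr \<alpha>)) * exp (real n powr \<alpha> * (e / 2))"
      using b1 b2 by (intro mult_left_mono) auto
    also have "\<dots> = exp (- (real n powr \<alpha> * (\<eta> * x powr \<alpha> - e / 2)))"
      using x by (simp add: mult_exp_exp powr_mult algebra_simps)
    also have "\<dots> \<le> exp (- (real n powr \<alpha> * (\<xi> * x powr \<alpha> - e)))"
      using \<eta>x n by (auto intro!: mult_left_mono)
    finally show ?case .
  qed
qed

text \<open>Adding both tails gives a factor 2, which half of \<open>e\<close> absorbs.\<close>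

lemma two_sided_tail:
  assumes x: "0 < x" and e: "0 < e" and k: "1 \<le> k"
  shows "\<forall>\<^sub>F n in sequentially. N.prob {\<omega> \<in> space N. real n * x \<le> \<bar>\<Sum>i=k..n. Y i \<omega>\<bar>}
    \<le> exp (- (real n powr \<alpha> * (\<xi> * x powr \<alpha> - e)))"
proof -
  interpret neg: stretched_sums M X \<alpha> \<xi> \<xi>\<^sub>0 N "\<lambda>i \<omega>. - Y i \<omega>" by (rule stretched_sums_uminus)
  have e2: "0 < e / 2" using e by simp
  have "filterlim (\<lambda>n. real n powr \<alpha> * (e / 2)) at_top sequentially"
    using \<alpha> e by real_asymp
  then have ev: "\<forall>\<^sub>F n in sequentially. ln 2 \<le> real n powr \<alpha> * (e / 2)"
    by (simp add: filterlim_at_top)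
  show ?thesis
    using upper_tail[OF x e2 k] neg.upper_tail[OF x e2 k] ev
  proof eventually_elim
    case (elim n)
    note [measurable] = sum_measurable[OF k]
    have "N.prob {\<omega> \<in> space N. real n * x \<le> \<bar>\<Sum>i=k..n. Y i \<omega>\<bar>}
      \<le> N.prob ({\<omega> \<in> space N. real n * x \<le> (\<Sum>i=k..n. Y i \<omega>)} \<union> {\<omega> \<in> space N. real n * x \<le> (\<Sum>i=k..n. - Y i \<omega>)})"
      by (intro N.finite_measure_mono) (auto simp: sum_negf abs_if split: if_splits)
    also have "\<dots> \<le> N.prob {\<omega> \<in> space N. real n * x \<le> (\<Sum>i=k..n. Y i \<omega>)} + N.prob {\<omega> \<in> space N. real n * x \<le> (\<Sum>i=k..n. - Y i \<omega>)}"
      by (intro measure_Un_le) (auto simp: sum_negf)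
    also have "\<dots> \<le> 2 * exp (- (real n powr \<alpha> * (\<xi> * x powr \<alpha> - e / 2)))" using elim by simp
    also have "\<dots> = exp (ln 2 + - (real n powr \<alpha> * (\<xi> * x powr \<alpha> - e / 2)))"
      by (simp only: exp_add exp_ln zero_less_numeral)
    also have "\<dots> \<le> exp (- (real n powr \<alpha> * (\<xi> * x powr \<alpha> - e)))" using elim(3) by (simp add: algebra_simps)
    finally show ?case .
  qed
qed

text \<open>A consequence of the two-sided tail bound, with \<open>e\<close> equal to half of the
  rate.\<close>

lemma weak_law:
  assumes "0 < d" "1 \<le> k"
  shows "\<forall>\<^sub>F n in sequentially. 1 / 2 \<le> N.prob {\<omega> \<in> space N. \<bar>\<Sum>i=k..n. Y i \<omega>\<bar> < real n * d}"
proof -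
  have e: "0 < \<xi> * d powr \<alpha> / 2" using \<xi>_pos assms by simp
  have "filterlim (\<lambda>n. real n powr \<alpha> * (\<xi> * d powr \<alpha> / 2)) at_top sequentially"
    using \<alpha> e by real_asymp
  then have ev: "\<forall>\<^sub>F n in sequentially. ln 2 \<le> real n powr \<alpha> * (\<xi> * d powr \<alpha> / 2)"
    by (simp add: filterlim_at_top)
  show ?thesis using two_sided_tail[OF assms(1) e assms(2)] ev
  proof eventually_elim
    case (elim n)
    note [measurable] = sum_measurable[OF assms(2)]
    have "N.prob {\<omega> \<in> space N. real n * d \<le> \<bar>\<Sum>i=k..n. Y i \<omega>\<bar>} \<le> exp (- (real n powr \<alpha> * (\<xi> * d powr \<alpha> / 2)))"
      using elim(1) by simp
    also have "\<dots> \<le> exp (- ln 2)" using elim(2) by (simp only: exp_le_cancel_iff neg_le_iff_le)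
    also have "\<dots> = (1 / 2 :: real)" by (simp add: exp_minus)
    finally have "N.prob {\<omega> \<in> space N. real n * d \<le> \<bar>\<Sum>i=k..n. Y i \<omega>\<bar>} \<le> 1 / 2" .
    moreover have "N.prob {\<omega> \<in> space N. \<not> real n * d \<le> \<bar>\<Sum>i=k..n. Y i \<omega>\<bar>}
        = 1 - N.prob {\<omega> \<in> space N. real n * d \<le> \<bar>\<Sum>i=k..n. Y i \<omega>\<bar>}"
      by (intro N.prob_neg) simp
    ultimately show ?case by (simp add: not_le)
  qed
qed

section \<open>Lower bound by one large summand\<close>

text \<open>The window for \<open>X\<close> is the one from \<open>u\<close> to
  \<open>\<rho> * u\<close> for the transformed variable, with
  \<open>u = (n * y) powr \<alpha>\<close> and
  \<open>\<rho> = (z / y) powr \<alpha>\<close>.\<close>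

lemma single_window:
  assumes "0 < y" "y < z"
  shows "\<exists>c>0. \<forall>\<^sub>F n in sequentially. c * exp (- (\<xi> * (real n * z) powr \<alpha>)) \<le> prob {\<omega> \<in> space M. X \<omega> \<in> {real n * y<..<real n * z}}"
proof -
  define \<rho> where "\<rho> = (z / y) powr \<alpha>"
  have \<rho>: "1 < \<rho>" using assms \<alpha> by (simp add: \<rho>_def gr_one_powr)
  obtain c where c: "0 < c" and ev: "\<forall>\<^sub>F u in at_top. c * exp (- (\<xi> * \<rho> * u)) \<le>
      prob {\<omega> \<in> space M. u < phi \<alpha> (X \<omega>) \<and> phi \<alpha> (X \<omega>) < \<rho> * u}"
    using window_lower_bound[OF \<rho>] by blast
  have "filterlim (\<lambda>n. (real n * y) powr \<alpha>) at_top sequentially"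
    using \<alpha> assms by real_asymp
  from filterlim_iff[THEN iffD1, OF this, rule_format, OF ev]
  have "\<forall>\<^sub>F n in sequentially. c * exp (- (\<xi> * (real n * z) powr \<alpha>)) \<le> prob {\<omega> \<in> space M. X \<omega> \<in> {real n * y<..<real n * z}}"
    using eventually_gt_at_top[of 0]
  proof eventually_elim
    case (elim n)
    have eq: "\<rho> * (real n * y) powr \<alpha> = (real n * z) powr \<alpha>"
      using assms by (simp add: \<rho>_def powr_divide powr_mult)
    have "c * exp (- (\<xi> * (real n * z) powr \<alpha>)) \<le>
        prob {\<omega> \<in> space M. (real n * y) powr \<alpha> < phi \<alpha> (X \<omega>) \<and> phi \<alpha> (X \<omega>) < (real n * z) powr \<alpha>}"
      using elim(1) by (simp add: mult.assoc eq)
    also have "\<dots> \<le> prob {\<omega> \<in> space M. X \<omega> \<in> {real n * y<..<real n * z}}"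
    proof (intro finite_measure_mono Collect_mono conj_mono impI)
      fix \<omega>
      have "0 < real n * y" "0 < real n * z" using assms elim(2) by auto
      then show "X \<omega> \<in> {real n * y<..<real n * z}"
        if "(real n * y) powr \<alpha> < phi \<alpha> (X \<omega>) \<and> phi \<alpha> (X \<omega>) < (real n * z) powr \<alpha>"
        using phi_window[OF \<alpha>(1), of "real n * y" "real n * z" "X \<omega>"] that by simp
    qed auto
    finally show ?case .
  qed
  with c show ?thesis by blast
qed

text \<open>Put \<open>Y 1 / n\<close> in a window just above \<open>x\<close>, and the remaining
  sum within \<open>n * d / 2\<close> of 0; independence multiplies the probabilities. The window
  lies strictly to the right of \<open>x\<close>, so that it stays away from 0 even if
  \<open>x = 0\<close>.\<close>

lemma lower_bound_nonneg:
  assumes x: "0 \<le> x" and d: "0 < d" and e: "0 < e"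
  shows "\<forall>\<^sub>F n in sequentially. exp (- (real n powr \<alpha> * (\<xi> * x powr \<alpha> + e)))
    \<le> N.prob {\<omega> \<in> space N. \<bar>(\<Sum>i=1..n. Y i \<omega>) / real n - x\<bar> < d}"
proof -
  have "((\<lambda>z. \<xi> * z powr \<alpha>) \<longlongrightarrow> \<xi> * x powr \<alpha>) (at_right x)"
  proof (intro tendsto_mult_left tendsto_powr2)
    show "\<forall>\<^sub>F z in at_right x. 0 \<le> z"
      using x by (auto simp: eventually_at_filter)
  qed (use \<alpha> in auto)
  then have "\<forall>\<^sub>F z in at_right x. \<xi> * z powr \<alpha> < \<xi> * x powr \<alpha> + e / 2"
    by (rule order_tendstoD) (use e in simp)
  moreover have "\<forall>\<^sub>F z in at_right x. z \<in> {x<..<x + d / 2}"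
    using d by (intro eventually_at_right_real) simp
  ultimately have "\<forall>\<^sub>F z in at_right x. \<xi> * z powr \<alpha> < \<xi> * x powr \<alpha> + e / 2 \<and> z \<in> {x<..<x + d / 2}"
    by eventually_elim simp
  then obtain z where z: "\<xi> * z powr \<alpha> < \<xi> * x powr \<alpha> + e / 2" "x < z" "z < x + d / 2"
    using eventually_happens'[OF trivial_limit_at_right_real] by fastforce
  define y where "y = (x + z) / 2"
  have y: "0 < y" "x < y" "y < z" using x z by (auto simp: y_def)
  obtain c where c: "0 < c" and ev: "\<forall>\<^sub>F n in sequentially. c * exp (- (\<xi> * (real n * z) powr \<alpha>))
      \<le> prob {\<omega> \<in> space M. X \<omega> \<in> {real n * y<..<real n * z}}"
    using single_window[OF y(1,3)] by blast
  have "filterlim (\<lambda>n. real n powr \<alpha> * (e / 2)) at_top sequentially"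
    using \<alpha> e by real_asymp
  \<comment> \<open>The constant \<open>2 / c\<close> collects the factor \<open>c\<close> of the
    window and the factor \<open>1 / 2\<close> of the weak law.\<close>
  then have ev': "\<forall>\<^sub>F n in sequentially. ln (2 / c) \<le> real n powr \<alpha> * (e / 2)"
    by (simp add: filterlim_at_top)
  have "0 < d / 2" using d by simp
  from weak_law[of "d / 2" 2, OF this one_le_numeral] ev ev' eventually_gt_at_top[of 0] show ?thesis
  proof eventually_elim
    case (elim n)
    let ?R = "\<lambda>\<omega>. \<Sum>i=2..n. Y i \<omega>"
    have mR[measurable]: "?R \<in> borel_measurable N" by (rule sum_measurable) simp
    have mY[measurable]: "Y 1 \<in> borel_measurable N" by (rule Y_measurable) simp
    have mS[measurable]: "(\<lambda>\<omega>. \<Sum>i=1..n. Y i \<omega>) \<in> borel_measurable N" by (rule sum_measurable) simp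
    have S: "(\<Sum>i=1..n. Y i \<omega>) = Y 1 \<omega> + ?R \<omega>" for \<omega>
      using elim(4) by (subst sum.atLeast_Suc_atMost) (auto simp: numeral_2_eq_2)
    have indep: "N.indep_var borel (Y 1) borel ?R"
      by (intro N.indep_vars_sum N.indep_vars_subset[OF Y_indep]) auto
    have abs_less: "\<bar>r\<bar> < a \<longleftrightarrow> r \<in> {- a<..<a}" for r a :: real by auto
    from N.indep_varD[OF indep, of "{real n * y<..<real n * z}" "{- (real n * (d / 2))<..<real n * (d / 2)}"]
    have joint: "N.prob {\<omega> \<in> space N. Y 1 \<omega> \<in> {real n * y<..<real n * z} \<and> \<bar>?R \<omega>\<bar> < real n * (d / 2)}
      = N.prob {\<omega> \<in> space N. Y 1 \<omega> \<in> {real n * y<..<real n * z}} * N.prob {\<omega> \<in> space N. \<bar>?R \<omega>\<bar> < real n * (d / 2)}"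
      unfolding abs_less by (simp add: vimage_def Int_def conj_commute conj_left_commute del: greaterThanLessThan_iff)
    have copy: "N.prob {\<omega> \<in> space N. Y 1 \<omega> \<in> {real n * y<..<real n * z}} = prob {\<omega> \<in> space M. X \<omega> \<in> {real n * y<..<real n * z}}"
      by (rule prob_copy) auto
    have "exp (- (real n powr \<alpha> * (\<xi> * x powr \<alpha> + e))) \<le> exp (- (real n powr \<alpha> * (\<xi> * z powr \<alpha>)) - ln (2 / c))"
    proof -
      have "real n powr \<alpha> * (\<xi> * z powr \<alpha>) \<le> real n powr \<alpha> * (\<xi> * x powr \<alpha> + e / 2)"
        using z(1) by (intro mult_left_mono) auto
      then show ?thesis using elim(3) by (simp add: algebra_simps)
    qed
    also have "\<dots> = c * exp (- (\<xi> * (real n * z) powr \<alpha>)) * (1 / 2)"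
      using c x z by (simp add: exp_diff powr_mult algebra_simps)
    also have "\<dots> \<le> N.prob {\<omega> \<in> space N. Y 1 \<omega> \<in> {real n * y<..<real n * z}} * N.prob {\<omega> \<in> space N. \<bar>?R \<omega>\<bar> < real n * (d / 2)}"
      unfolding copy using elim(1,2) c by (intro mult_mono) auto
    also have "\<dots> = N.prob {\<omega> \<in> space N. Y 1 \<omega> \<in> {real n * y<..<real n * z} \<and> \<bar>?R \<omega>\<bar> < real n * (d / 2)}"
      by (rule joint[symmetric])
    also have "\<dots> \<le> N.prob {\<omega> \<in> space N. \<bar>(\<Sum>i=1..n. Y i \<omega>) / real n - x\<bar> < d}"
    proof (intro N.finite_measure_mono subsetI CollectI conjI)
      fix \<omega> assume \<omega>: "\<omega> \<in> {\<omega> \<in> space N. Y 1 \<omega> \<in> {real n * y<..<real n * z} \<and> \<bar>?R \<omega>\<bar> < real n * (d / 2)}"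
      then show "\<omega> \<in> space N" by simp
      have "y < Y 1 \<omega> / real n" "Y 1 \<omega> / real n < z" "\<bar>?R \<omega> / real n\<bar> < d / 2"
        using \<omega> elim(4) by (auto simp: field_simps)
      then show "\<bar>(\<Sum>i=1..n. Y i \<omega>) / real n - x\<bar> < d"
        unfolding S add_divide_distrib using y z by linarith
    qed measurable
    finally show ?case by simp
  qed
qed

lemma lower_bound:
  assumes d: "0 < d" and e: "0 < e"
  shows "\<forall>\<^sub>F n in sequentially. exp (- (real n powr \<alpha> * (\<xi> * \<bar>x\<bar> powr \<alpha> + e)))
    \<le> N.prob {\<omega> \<in> space N. \<bar>(\<Sum>i=1..n. Y i \<omega>) / real n - x\<bar> < d}"
proof (cases "0 \<le> x")
  case True
  then show ?thesis using lower_bound_nonneg[OF True d e] by simp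
next
  case False
  interpret neg: stretched_sums M X \<alpha> \<xi> \<xi>\<^sub>0 N "\<lambda>i \<omega>. - Y i \<omega>" by (rule stretched_sums_uminus)
  have "\<bar>(\<Sum>i=1..n. - Y i \<omega>) / real n - (- x)\<bar> = \<bar>(\<Sum>i=1..n. Y i \<omega>) / real n - x\<bar>" for n \<omega>
    unfolding sum_negf by (simp add: abs_minus_commute)
  then show ?thesis using neg.lower_bound_nonneg[OF _ d e, of "- x"] False by simp
qed

section \<open>From tail estimates to the large deviations principle\<close>

text \<open>For positive \<open>c'\<close> the set \<open>B\<close> avoids the interval of radius
  \<open>b\<close> around 0 with \<open>\<xi> * b powr \<alpha> = c'\<close>, and
  \<open>c' - c\<close> is the slack in the tail bound. Otherwise the right side is at least
  1.\<close>

lemma eventually_prob_le: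
  assumes B: "B \<in> sets borel" and c: "\<And>x. x \<in> B \<Longrightarrow> c' \<le> \<xi> * \<bar>x\<bar> powr \<alpha>" and "c < c'"
  shows "\<forall>\<^sub>F n in sequentially. N.prob {\<omega> \<in> space N. (1 / real n) * (\<Sum>i=1..n. Y i \<omega>) \<in> B} \<le> exp (- (real n powr \<alpha> * c))"
proof (cases "0 < c'")
  case False
  with \<open>c < c'\<close> have "c \<le> 0" by simp
  have "N.prob {\<omega> \<in> space N. (1 / real n) * (\<Sum>i=1..n. Y i \<omega>) \<in> B} \<le> exp (- (real n powr \<alpha> * c))" for n
    using \<open>c \<le> 0\<close> by (intro order_trans[OF N.prob_le_1]) (simp add: mult_nonneg_nonpos)
  then show ?thesis by simp
next
  case True
  define b where "b = (c' / \<xi>) powr (1 / \<alpha>)"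
  have b: "0 < b" "\<xi> * b powr \<alpha> = c'" using True \<xi>_pos \<alpha> by (simp_all add: b_def powr_powr)
  have bB: "b \<le> \<bar>x\<bar>" if "x \<in> B" for x
  proof (rule ccontr)
    assume "\<not> b \<le> \<bar>x\<bar>"
    then have "\<bar>x\<bar> powr \<alpha> < b powr \<alpha>" using \<alpha> by (intro powr_less_mono2) auto
    then have "\<xi> * \<bar>x\<bar> powr \<alpha> < \<xi> * b powr \<alpha>" using \<xi>_pos by simp
    then show False using c[OF that] b(2) by simp
  qed
  have "0 < c' - c" using assms by simp
  from two_sided_tail[OF b(1) this order_refl] eventually_gt_at_top[of 0]
  show ?thesis
  proof eventually_elim
    case (elim n)
    note [measurable] = sum_measurable[OF order_refl]
    have "N.prob {\<omega> \<in> space N. (1 / real n) * (\<Sum>i=1..n. Y i \<omega>) \<in> B}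
      \<le> N.prob {\<omega> \<in> space N. real n * b \<le> \<bar>\<Sum>i=1..n. Y i \<omega>\<bar>}"
    proof (intro N.finite_measure_mono Collect_mono conj_mono impI)
      fix \<omega> assume "(1 / real n) * (\<Sum>i=1..n. Y i \<omega>) \<in> B"
      from bB[OF this] show "real n * b \<le> \<bar>\<Sum>i=1..n. Y i \<omega>\<bar>"
        using elim(2) by (simp add: abs_mult field_simps)
    qed measurable
    also have "\<dots> \<le> exp (- (real n powr \<alpha> * c))" using elim(1) b(2) by simp
    finally show ?case .
  qed
qed

lemma eventually_prob_ge:
  assumes B: "B \<in> sets borel" and x: "x \<in> interior B" and e: "0 < e"
  shows "\<forall>\<^sub>F n in sequentially. exp (- (real n powr \<alpha> * (\<xi> * \<bar>x\<bar> powr \<alpha> + e)))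
    \<le> N.prob {\<omega> \<in> space N. (1 / real n) * (\<Sum>i=1..n. Y i \<omega>) \<in> B}"
proof -
  obtain d where d: "0 < d" "ball x d \<subseteq> B" using x by (auto simp: mem_interior)
  show ?thesis using lower_bound[OF d(1) e, of x]
  proof eventually_elim
    case (elim n)
    note [measurable] = sum_measurable[OF order_refl] B
    have "N.prob {\<omega> \<in> space N. \<bar>(\<Sum>i=1..n. Y i \<omega>) / real n - x\<bar> < d}
      \<le> N.prob {\<omega> \<in> space N. (1 / real n) * (\<Sum>i=1..n. Y i \<omega>) \<in> B}"
    proof (intro N.finite_measure_mono Collect_mono conj_mono impI)
      fix \<omega> assume "\<bar>(\<Sum>i=1..n. Y i \<omega>) / real n - x\<bar> < d"
      then have "(\<Sum>i=1..n. Y i \<omega>) / real n \<in> ball x d" by (simp add: dist_real_def abs_minus_commute)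
      then show "(1 / real n) * (\<Sum>i=1..n. Y i \<omega>) \<in> B" using d(2) by auto
    qed measurable
    then show ?case using elim by simp
  qed
qed

lemma large_deviations:
  "large_deviations_principle N (\<lambda>n \<omega>. (1 / real n) * (\<Sum>i=1..n. Y i \<omega>))
     (\<lambda>n. real n powr \<alpha>) (\<lambda>x. ereal (\<xi> * \<bar>x\<bar> powr \<alpha>))"
  unfolding large_deviations_principle_def
proof (intro conjI allI impI ballI)
  fix n :: nat
  show "(\<lambda>\<omega>. (1 / real n) * (\<Sum>i=1..n. Y i \<omega>)) \<in> borel_measurable N"
    using sum_measurable[OF order_refl] by measurable
next
  fix x show "0 \<le> ereal (\<xi> * \<bar>x\<bar> powr \<alpha>)" using \<xi>_pos by simp
next
  have "continuous_on UNIV (\<lambda>x. ereal (\<xi> * \<bar>x\<bar> powr \<alpha>))"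
    using \<alpha> by (intro continuous_on_ereal continuous_intros continuous_on_powr') auto
  then show "lower_semicontinuous (\<lambda>x. ereal (\<xi> * \<bar>x\<bar> powr \<alpha>))"
    unfolding lower_semicontinuous_def by (intro allI open_Collect_less continuous_on_const)
next
  fix B :: "real set" assume B: "B \<in> sets borel"
  define L where "L n = ereal (1 / real n powr \<alpha>)
    * ext_log (emeasure N {\<omega> \<in> space N. (1 / real n) * (\<Sum>i=1..n. Y i \<omega>) \<in> B})" for n
  have L: "L n = ereal (1 / real n powr \<alpha>)
    * ext_log (ennreal (N.prob {\<omega> \<in> space N. (1 / real n) * (\<Sum>i=1..n. Y i \<omega>) \<in> B}))" for n
    by (simp add: L_def N.emeasure_eq_measure)
  show "- (INF x\<in>interior B. ereal (\<xi> * \<bar>x\<bar> powr \<alpha>)) \<le> liminf L"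
  proof -
    have "- liminf L \<le> ereal (\<xi> * \<bar>x\<bar> powr \<alpha>)" if x: "x \<in> interior B" for x
    proof (rule ereal_le_epsilon2)
      fix e :: real assume e: "0 < e"
      have "\<forall>\<^sub>F n in sequentially. ereal (- (\<xi> * \<bar>x\<bar> powr \<alpha> + e)) \<le> L n"
        using eventually_prob_ge[OF B x e] eventually_gt_at_top[of 0]
        unfolding L by eventually_elim (rule scaled_ext_log_ge, auto)
      then have "ereal (- (\<xi> * \<bar>x\<bar> powr \<alpha> + e)) \<le> liminf L" by (rule Liminf_bounded)
      then have "- liminf L \<le> - ereal (- (\<xi> * \<bar>x\<bar> powr \<alpha> + e))" by (simp only: ereal_minus_le_minus)
      then show "- liminf L \<le> ereal (\<xi> * \<bar>x\<bar> powr \<alpha>) + ereal e" by (simp add: add.commute)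
    qed
    then have "- liminf L \<le> (INF x\<in>interior B. ereal (\<xi> * \<bar>x\<bar> powr \<alpha>))" by (rule INF_greatest)
    then show ?thesis by (simp add: ereal_uminus_le_reorder)
  qed
  show "liminf L \<le> limsup L" by (rule Liminf_le_Limsup) simp
  show "limsup L \<le> - (INF x\<in>closure B. ereal (\<xi> * \<bar>x\<bar> powr \<alpha>))"
  proof -
    let ?m = "INF x\<in>closure B. ereal (\<xi> * \<bar>x\<bar> powr \<alpha>)"
    have "?m \<le> - limsup L"
    \<comment> \<open>Comparing with real numbers below the infimum also covers an infinite infimum,
      that is, empty \<open>B\<close>.\<close>
    proof (rule ccontr)
      assume "\<not> ?m \<le> - limsup L"
      then obtain c where c: "- limsup L < ereal c" "ereal c < ?m"
        using ereal_dense2[of "- limsup L" ?m] by (auto simp: not_le)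
      \<comment> \<open>A second real number supplies the strict gap that
        \<open>eventually_prob_le\<close> requires.\<close>
      then obtain c' where c': "c < c'" "ereal c' < ?m" using ereal_dense2[OF c(2)] by auto
      have "c' \<le> \<xi> * \<bar>x\<bar> powr \<alpha>" if "x \<in> B" for x
      proof -
        have "?m \<le> ereal (\<xi> * \<bar>x\<bar> powr \<alpha>)" using that closure_subset by (intro INF_lower) auto
        with c'(2) have "ereal c' < ereal (\<xi> * \<bar>x\<bar> powr \<alpha>)" by (rule less_le_trans)
        then show ?thesis by simp
      qed
      then have "\<forall>\<^sub>F n in sequentially. N.prob {\<omega> \<in> space N. (1 / real n) * (\<Sum>i=1..n. Y i \<omega>) \<in> B}
          \<le> exp (- (real n powr \<alpha> * c))"
        using c'(1) by (rule eventually_prob_le[OF B])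
      with eventually_gt_at_top[of 0] have "\<forall>\<^sub>F n in sequentially. L n \<le> ereal (- c)"
        unfolding L by eventually_elim (rule scaled_ext_log_le, auto)
      then have "limsup L \<le> ereal (- c)" by (rule Limsup_bounded)
      then have "- ereal (- c) \<le> - limsup L" by (simp only: ereal_minus_le_minus)
      then show False using c(1) by simp
    qed
    then have "- (- limsup L) \<le> - ?m" by (simp only: ereal_minus_le_minus)
    then show ?thesis by simp
  qed
qed

end

section \<open>Translation of the hypotheses on the log-Laplace transform\<close>

lemma lam_finite_iff:
  assumes "X \<in> borel_measurable M"
  shows "lam M X \<alpha> \<eta> < \<infinity> \<longleftrightarrow> integrable M (\<lambda>\<omega>. exp (\<eta> * phi \<alpha> (X \<omega>)))"
proof -
  have [measurable]: "X \<in> borel_measurable M" by (rule assms)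
  have "(\<lambda>\<omega>. exp (\<eta> * phi \<alpha> (X \<omega>))) \<in> borel_measurable M" by measurable
  then show ?thesis
    by (auto simp: lam_def ext_log_def integrable_iff_bounded less_top[symmetric])
qed

lemma expectation_phi_symmetric:
  assumes X[measurable]: "X \<in> borel_measurable M" and "distr M borel (\<lambda>\<omega>. - X \<omega>) = distr M borel X"
  shows "(\<integral>\<omega>. phi \<alpha> (X \<omega>) \<partial>M) = 0"
proof -
  have "(\<integral>x. phi \<alpha> x \<partial>distr M borel (\<lambda>\<omega>. - X \<omega>)) = (\<integral>\<omega>. phi \<alpha> (- X \<omega>) \<partial>M)"
    by (rule integral_distr) auto
  moreover have "(\<integral>x. phi \<alpha> x \<partial>distr M borel X) = (\<integral>\<omega>. phi \<alpha> (X \<omega>) \<partial>M)"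
    by (rule integral_distr) auto
  ultimately show ?thesis using assms(2) by (simp add: phi_def sgn_minus)
qed

theorem theorem1:
  fixes M :: "'a measure" and X :: "'a \<Rightarrow> real"
    and N :: "'b measure" and Y :: "nat \<Rightarrow> 'b \<Rightarrow> real"
    and \<alpha> \<xi> :: real
  assumes "prob_space M" and "X \<in> borel_measurable M"
    and symmetric: "distr M borel (\<lambda>\<omega>. - X \<omega>) = distr M borel X"
    and moments: "\<And>k::nat. integrable M (\<lambda>\<omega>. \<bar>X \<omega>\<bar> ^ k)"
    and alpha: "0 < \<alpha>" "\<alpha> < 1"
    and bounded_domain: "0 < \<xi>" "{\<eta>. lam M X \<alpha> \<eta> < \<infinity>} = {-\<xi><..<\<xi>}"
    and steepness: "\<And>\<eta> :: nat \<Rightarrow> real. range \<eta> \<subseteq> {-\<xi><..<\<xi>} \<Longrightarrow>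
          \<eta> \<longlonglongrightarrow> \<xi> \<or> \<eta> \<longlonglongrightarrow> -\<xi> \<Longrightarrow>
          filterlim (\<lambda>n. \<bar>lam' M X \<alpha> (\<eta> n)\<bar>) at_top sequentially"
    and relative_variance: "\<exists>\<xi>\<^sub>0\<in>{0<..<\<xi>}. \<exists>\<omega>>0.
          mono_on {\<xi>\<^sub>0..<\<xi>} (lam'' M X \<alpha>) \<and>
          antimono_on {\<xi>\<^sub>0..<\<xi>} (rel_var M X \<alpha>) \<and>
          (\<forall>\<eta>\<in>{\<xi>\<^sub>0<..<\<xi>}. rel_var M X \<alpha> \<eta> \<le> \<omega>)"
    and "prob_space N"
    and independent: "prob_space.indep_vars N (\<lambda>_. borel) Y {1..}"
    and copies: "\<And>i. 1 \<le> i \<Longrightarrow> distr N borel (Y i) = distr M borel X"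
  shows "large_deviations_principle N (\<lambda>n \<omega>. (1 / real n) * (\<Sum>i=1..n. Y i \<omega>))
           (\<lambda>n. real n powr \<alpha>) (\<lambda>x. ereal (\<xi> * \<bar>x\<bar> powr \<alpha>))"
proof -
  let ?T = "\<lambda>\<omega>. phi \<alpha> (X \<omega>)"
  have [measurable]: "X \<in> borel_measurable M" by fact
  interpret N: prob_space N by fact
  have dom: "integrable M (\<lambda>\<omega>. exp (\<eta> * ?T \<omega>)) \<longleftrightarrow> \<bar>\<eta>\<bar> < \<xi>" for \<eta>
  proof -
    have "integrable M (\<lambda>\<omega>. exp (\<eta> * ?T \<omega>)) \<longleftrightarrow> \<eta> \<in> {\<eta>. lam M X \<alpha> \<eta> < \<infinity>}"
      using lam_finite_iff[OF \<open>X \<in> borel_measurable M\<close>, of \<alpha> \<eta>] by simp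
    also have "\<dots> \<longleftrightarrow> \<bar>\<eta>\<bar> < \<xi>" unfolding bounded_domain(2) by auto
    finally show ?thesis .
  qed
  interpret T: exp_moments M ?T \<xi>
    using \<open>prob_space M\<close> bounded_domain(1) dom by (intro exp_moments.intro exp_moments_axioms.intro) auto
  have lam: "real_of_ereal (lam M X \<alpha> \<eta>) = ln (T.mom 0 \<eta>)" if "\<bar>\<eta>\<bar> < \<xi>" for \<eta>
  proof -
    have "(\<integral>\<^sup>+ \<omega>. ennreal (exp (\<eta> * ?T \<omega>)) \<partial>M) = ennreal (T.mom 0 \<eta>)"
      using dom that by (subst nn_integral_eq_integral) (auto simp: T.mom_def)
    then show ?thesis using T.mom_pos[OF that] by (simp add: lam_def ext_log_ennreal)
  qed
  have dom_open: "open {- \<xi><..<\<xi>}" by simp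
  \<comment> \<open>The real-valued function agrees with \<open>ln (T.mom 0 \<eta>)\<close> only on
    the open domain, so the derivative is transferred locally.\<close>
  have lam': "lam' M X \<alpha> \<eta> = T.tmean \<eta>" if \<eta>: "\<bar>\<eta>\<bar> < \<xi>" for \<eta>
    unfolding lam'_def
    by (intro DERIV_imp_deriv has_field_derivative_transform_within_open[OF T.ln_mom_has_derivative[OF \<eta>] dom_open])
      (use \<eta> lam in auto)
  have lam'': "lam'' M X \<alpha> \<eta> = T.tvar \<eta>" if \<eta>: "\<bar>\<eta>\<bar> < \<xi>" for \<eta>
    unfolding lam''_def
    by (intro DERIV_imp_deriv has_field_derivative_transform_within_open[OF T.tmean_has_derivative[OF \<eta>] dom_open])
      (use \<eta> lam' in auto)
  obtain \<xi>\<^sub>0 where \<xi>\<^sub>0: "0 < \<xi>\<^sub>0" "\<xi>\<^sub>0 < \<xi>" "antimono_on {\<xi>\<^sub>0..<\<xi>} (rel_var M X \<alpha>)"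
    using relative_variance by auto
  have Tint: "integrable M ?T" using T.moment_integrable[of 0 1] bounded_domain(1) by simp
  have Tmean: "T.expectation ?T = 0"
    by (rule expectation_phi_symmetric) (use symmetric in auto)
  interpret stretched_sums M X \<alpha> \<xi> \<xi>\<^sub>0 N Y
  proof
    show "antimono_on {\<xi>\<^sub>0..<\<xi>} T.trel"
    proof (rule monotone_onI)
      fix a b assume ab: "a \<in> {\<xi>\<^sub>0..<\<xi>}" "b \<in> {\<xi>\<^sub>0..<\<xi>}" "a \<le> b"
      have "rel_var M X \<alpha> b \<le> rel_var M X \<alpha> a" using monotone_onD[OF \<xi>\<^sub>0(3)] ab by auto
      then show "T.trel b \<le> T.trel a"
        using ab \<xi>\<^sub>0(1) by (simp add: rel_var_def T.trel_def lam' lam'')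
    qed
    fix K a :: real assume a: "a < \<xi>"
    define a' where "a' = max a 0"
    \<comment> \<open>The shift by 2 keeps the fraction below 1 also at \<open>n = 0\<close>, so
      every term is strictly above \<open>a'\<close>.\<close>
    define \<eta> where "\<eta> n = \<xi> - (\<xi> - a') * (1 / (real n + 2))" for n
    have a': "a \<le> a'" "0 \<le> a'" "a' < \<xi>" using a bounded_domain(1) by (auto simp: a'_def)
    have \<eta>: "a' < \<eta> n" "\<eta> n < \<xi>" for n
    proof -
      have "(\<xi> - a') * (1 / (real n + 2)) < (\<xi> - a') * 1"
        using a' by (intro mult_strict_left_mono) auto
      moreover have "0 < (\<xi> - a') * (1 / (real n + 2))" using a' by (intro mult_pos_pos) auto
      ultimately show "a' < \<eta> n" "\<eta> n < \<xi>" by (simp_all add: \<eta>_def)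
    qed
    have "(\<lambda>n. 1 / (real n + 2)) \<longlonglongrightarrow> 0" by real_asymp
    then have "\<eta> \<longlonglongrightarrow> \<xi> - (\<xi> - a') * 0" unfolding \<eta>_def by (intro tendsto_intros)
    then have "\<eta> \<longlonglongrightarrow> \<xi> \<or> \<eta> \<longlonglongrightarrow> - \<xi>" by simp
    moreover have "\<eta> n \<in> {- \<xi><..<\<xi>}" for n using \<eta>[of n] a' by simp
    ultimately have "filterlim (\<lambda>n. \<bar>lam' M X \<alpha> (\<eta> n)\<bar>) at_top sequentially"
      by (intro steepness) auto
    then have "\<forall>\<^sub>F n in sequentially. K < \<bar>lam' M X \<alpha> (\<eta> n)\<bar>"
      by (simp add: filterlim_at_top_dense)
    then obtain n where "K < \<bar>lam' M X \<alpha> (\<eta> n)\<bar>"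
      by (auto dest: eventually_happens)
    moreover have "\<bar>\<eta> n\<bar> < \<xi>" "0 \<le> \<eta> n" using \<eta>[of n] a' by auto
    ultimately have "K < T.tmean (\<eta> n)"
      using T.tmean_nonneg[OF Tint Tmean, of "\<eta> n"] \<eta>[of n] by (simp add: lam')
    then show "\<exists>\<eta>>a. \<eta> < \<xi> \<and> K < T.tmean \<eta>"
      using \<eta>[of n] a' by (intro exI[of _ "\<eta> n"]) auto
  next
    show "integrable M X"
      using moments[of 1] by (simp add: integrable_abs_iff[OF \<open>X \<in> borel_measurable M\<close>])
  qed (use Tint Tmean \<xi>\<^sub>0 symmetric alpha independent copies in auto)
  show ?thesis by (rule large_deviations)
qed

end
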